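(* Let $(R,\mathfrak m,k)$ be a one-dimensional local Noetherian domain with infinite residue field which is analytically irreducible and residually rational, and assume that $R$ is almost Gorenstein, of Cohen-Macaulay type $r$. Let $I$ be an $\mathfrak m$-primary ideal of $R$ which is not principal, let $\Lambda=\Lambda(I)$ be the blowing-up of $R$ along $I$, and let $e=e(I)$, $\nu=\nu(I)$, $\rho=\rho(I)$. Then: (1) $2\rho=e\nu+r-1-l_R\big((R:\Lambda)/I^{\nu}\big)-l_R(\Lambda^{**}/\Lambda)$. (2) The following conditions are equivalent: (a) $2\rho=e\nu+r-1$; (b) $\Lambda$ is Gorenstein and $c-c_\Lambda=e\nu$; (c) $R:\Lambda=I^{\nu}$; (d) $\omega:\Lambda=I^{\nu}$. When the conditions in (2) hold, the following (mutually equivalent) conditions also hold: $\omega\subseteq\Lambda$; $\omega\Lambda=\Lambda$; $\omega:\Lambda=R:\Lambda$; $I^n=I^n\omega\cap R$ for all $n\ge\nu$; $\omega I^n=I^n$ for all $n\ge\nu$; there exists $n>0$ such that $\omega I^n=I^n$.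
   Context: Setting: $K$ is the quotient field of $R$; the integral closure $\overline R$ of $R$ in $K$ is a finite $R$-module and a DVR with uniformizer $t$ (analytic irreducibility), and $k\simeq\overline R/t\overline R$ (residual rationality). $v$ is the valuation of $\overline R$, $v(t)=1$. $l_R$ denotes length of $R$-modules. Fractional ideals are nonzero; for fractional ideals $J,L$ put $J:L=\{y\in K: yL\subseteq J\}$ and $J^{**}=R:(R:J)$. Blowing-up: $\Lambda(I)=\bigcup_{n\ge0}(I^n:I^n)$. An element $x\in I$ with $I^{n+1}=xI^n$ for $n\gg0$ is a minimal reduction of $I$. $e(I)=l_R(R/xR)=v(x)$ is the multiplicity; $\nu(I)$ (reduction exponent) is the least integer such that $I^{n+1}=xI^n$ for all $n\ge\nu(I)$; $\rho(I)=l_R(\Lambda/R)$ is the genus. One has $I^\nu\subseteq R:\Lambda$. $\gamma_R=R:\overline R$, $c=l_R(\overline R/\gamma_R)$, $\delta=l_R(\overline R/R)$; $\gamma_\Lambda=\Lambda:\overline R$, $c_\Lambda=l_R(\overline R/\gamma_\Lambda)$. $\omega$ is a canonical module of $R$, i.e. a fractional ideal with $\omega:(\omega:J)=J$ for every fractional ideal $J$, chosen so that $R\subseteq\omega\subseteq\overline R$. The Cohen-Macaulay type is $r=l_R((R:\mathfrak m)/R)$. $R$ is almost Gorenstein if $\mathfrak m=\mathfrak m\omega$; equivalently $r-1=2\delta-c$; equivalently $R:\omega\supseteq\mathfrak m$. *)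

theory Defs
  imports "HOL-Algebra.Algebra" "HOL-Algebra.Algebraic_Closure_Type" "HOL-Library.Extended_Nat"
begin

text \<open>
  The quotient field \<open>K\<close> is a type of class \<open>field\<close>.  \<open>R\<close>, its overrings and all fractional
  ideals are subsets of this type; a subset \<open>S\<close> that is a subring is turned into a ring of
  HOL-Algebra by \<open>ring_on S\<close>.
\<close>

abbreviation ring_on :: "'a::field set \<Rightarrow> 'a ring" where
  "ring_on S \<equiv> (ring_of_type_algebra :: 'a ring)\<lparr>carrier := S\<rparr>"

text \<open>\<open>K\<close> with multiplication as scalar action: a module over \<open>ring_on S\<close> for every subring \<open>S\<close>.\<close>

definition field_module :: "('a::field, 'a) module" where
  "field_module = \<lparr>carrier = UNIV, monoid.mult = (*), one = 1, ring.zero = 0, add = (+), module.smult = (*)\<rparr>"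

definition is_quotient_field_of :: "'a::field set \<Rightarrow> bool" where
  "is_quotient_field_of S \<longleftrightarrow> (\<forall>y. \<exists>a\<in>S. \<exists>b\<in>S. b \<noteq> 0 \<and> y = a / b)"


subsection \<open>Rings\<close>

definition krull_dim :: "('a, 'm) ring_scheme \<Rightarrow> enat" where
  "krull_dim A = Sup {enat n | n P. (\<forall>i\<le>n. primeideal (P i) A) \<and> (\<forall>i<n. P i \<subset> P (Suc i))}"

definition local_ring :: "('a, 'm) ring_scheme \<Rightarrow> 'a set \<Rightarrow> bool" where
  "local_ring A \<mm> \<longleftrightarrow> cring A \<and> maximalideal \<mm> A \<and> (\<forall>\<nn>. maximalideal \<nn> A \<longrightarrow> \<nn> = \<mm>)"

definition discrete_valuation_ring :: "('a, 'm) ring_scheme \<Rightarrow> bool" where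
  "discrete_valuation_ring A \<longleftrightarrow> principal_domain A \<and> (\<exists>\<nn>. local_ring A \<nn>) \<and> \<not> field A"

definition radical_of :: "('a, 'm) ring_scheme \<Rightarrow> 'a set \<Rightarrow> 'a set" where
  "radical_of A Q = {a \<in> carrier A. \<exists>n::nat. a [^]\<^bsub>A\<^esub> n \<in> Q}"

definition primary_ideal :: "('a, 'm) ring_scheme \<Rightarrow> 'a set \<Rightarrow> bool" where
  "primary_ideal A Q \<longleftrightarrow> ideal Q A \<and> Q \<noteq> carrier A \<and>
     (\<forall>a\<in>carrier A. \<forall>b\<in>carrier A. a \<otimes>\<^bsub>A\<^esub> b \<in> Q \<longrightarrow> a \<in> Q \<or> b \<in> radical_of A Q)"

text \<open>
  Length of the \<open>A\<close>-module \<open>J/L\<close> for submodules \<open>L \<subseteq> J\<close> of \<open>M\<close>: the supremum of the lengths of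
  chains of submodules of \<open>J/L\<close>, which are the submodules of \<open>M\<close> between \<open>L\<close> and \<open>J\<close>.
\<close>

definition quotient_length ::
    "('a, 'm) ring_scheme \<Rightarrow> ('a, 'b, 'n) module_scheme \<Rightarrow> 'b set \<Rightarrow> 'b set \<Rightarrow> enat" where
  "quotient_length A M J L =
     Sup {enat n | n N. (\<forall>i\<le>n. submodule (N i) A M \<and> L \<subseteq> N i \<and> N i \<subseteq> J) \<and>
                        (\<forall>i<n. N i \<subset> N (Suc i))}"

text \<open>\<open>len R J L\<close> is \<open>l\<^sub>R(J/L)\<close> as a natural number (used only where this length is finite).\<close>

definition len :: "'a::field set \<Rightarrow> 'a set \<Rightarrow> 'a set \<Rightarrow> nat" where
  "len R J L = the_enat (quotient_length (ring_on R) field_module J L)"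


subsection \<open>Integral closure\<close>

definition int_closure :: "'a::field set \<Rightarrow> 'a set" where
  "int_closure R = {x. \<exists>p. lead_coeff p = 1 \<and> range (poly.coeff p) \<subseteq> R \<and> poly p x = 0}"

definition finite_module_over :: "'a::field set \<Rightarrow> 'a set \<Rightarrow> bool" where
  "finite_module_over R S \<longleftrightarrow> (\<exists>B. finite B \<and> S = {\<Sum>b\<in>B. f b * b | f. f ` B \<subseteq> R})"

definition analytically_irreducible :: "'a::field set \<Rightarrow> bool" where
  "analytically_irreducible R \<longleftrightarrow>
     finite_module_over R (int_closure R) \<and> discrete_valuation_ring (ring_on (int_closure R))"

text \<open>
  The canonical homomorphism from \<open>R/\<mm>\<close> to the residue field of the integral closure is an
  isomorphism.  It sends a coset \<open>C = \<mm> + a\<close> to \<open>\<nn> + C = \<nn> + a\<close>.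
\<close>

definition residually_rational :: "'a::field set \<Rightarrow> 'a set \<Rightarrow> bool" where
  "residually_rational R \<mm> \<longleftrightarrow>
     (\<exists>\<nn>. local_ring (ring_on (int_closure R)) \<nn> \<and>
        (\<lambda>C. \<nn> <+>\<^bsub>ring_on (int_closure R)\<^esub> C)
          \<in> ring_iso (ring_on R Quot \<mm>) (ring_on (int_closure R) Quot \<nn>))"


subsection \<open>Fractional ideals\<close>

definition fractional_ideal :: "'a::field set \<Rightarrow> 'a set \<Rightarrow> bool" where
  "fractional_ideal S J \<longleftrightarrow> submodule J (ring_on S) field_module \<and> J \<noteq> {0} \<and>
     (\<exists>d\<in>S. d \<noteq> 0 \<and> (*) d ` J \<subseteq> S)"

definition colon :: "'a::field set \<Rightarrow> 'a set \<Rightarrow> 'a set" where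
  "colon J L = {y. \<forall>z\<in>L. y * z \<in> J}"

abbreviation fprod :: "'a::field set \<Rightarrow> 'a set \<Rightarrow> 'a set" where
  "fprod J L \<equiv> ideal_prod ring_of_type_algebra J L"

primrec fpow :: "'a::field set \<Rightarrow> 'a set \<Rightarrow> nat \<Rightarrow> 'a set" where
  "fpow R J 0 = R"
| "fpow R J (Suc n) = fprod J (fpow R J n)"

definition bidual :: "'a::field set \<Rightarrow> 'a set \<Rightarrow> 'a set" where
  "bidual R J = colon R (colon R J)"

definition conductor :: "'a::field set \<Rightarrow> 'a set \<Rightarrow> 'a set" where
  "conductor R S = colon S (int_closure R)"

definition canonical_ideal :: "'a::field set \<Rightarrow> 'a set \<Rightarrow> bool" where
  "canonical_ideal S \<omega> \<longleftrightarrow> fractional_ideal S \<omega> \<and>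
     (\<forall>J. fractional_ideal S J \<longrightarrow> colon \<omega> (colon \<omega> J) = J)"

text \<open>A one-dimensional local ring \<open>S\<close> is Gorenstein if it is its own canonical module.\<close>

definition gorenstein :: "'a::field set \<Rightarrow> bool" where
  "gorenstein S \<longleftrightarrow> canonical_ideal S S"

definition almost_gorenstein :: "'a::field set \<Rightarrow> 'a set \<Rightarrow> bool" where
  "almost_gorenstein \<mm> \<omega> \<longleftrightarrow> \<mm> = fprod \<mm> \<omega>"

definition cm_type :: "'a::field set \<Rightarrow> 'a set \<Rightarrow> nat" where
  "cm_type R \<mm> = len R (colon R \<mm>) R"


subsection \<open>Blowing-up\<close>

definition blowup :: "'a::field set \<Rightarrow> 'a set \<Rightarrow> 'a set" where
  "blowup R I = (\<Union>n. colon (fpow R I n) (fpow R I n))"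

definition minimal_reduction :: "'a::field set \<Rightarrow> 'a set \<Rightarrow> 'a \<Rightarrow> bool" where
  "minimal_reduction R I x \<longleftrightarrow>
     x \<in> I \<and> (\<forall>\<^sub>F n in sequentially. fpow R I (Suc n) = (*) x ` fpow R I n)"

text \<open>
  The multiplicity and the reduction exponent are computed from a minimal reduction \<open>x\<close> but do
  not depend on its choice; \<open>THE\<close> picks the common value.
\<close>

definition multiplicity_of :: "'a::field set \<Rightarrow> 'a set \<Rightarrow> nat" where
  "multiplicity_of R I = (THE e. \<exists>x. minimal_reduction R I x \<and> e = len R R ((*) x ` R))"

definition reduction_exponent :: "'a::field set \<Rightarrow> 'a set \<Rightarrow> nat" where
  "reduction_exponent R I =
     (THE \<nu>. \<exists>x. minimal_reduction R I x \<and>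
        \<nu> = (LEAST N. \<forall>n\<ge>N. fpow R I (Suc n) = (*) x ` fpow R I n))"

definition genus :: "'a::field set \<Rightarrow> 'a set \<Rightarrow> nat" where
  "genus R I = len R (blowup R I) R"

end

theory Submission
  imports Defs
begin

text \<open>
  The normalisation \<open>V\<close> of \<open>R\<close> is a discrete valuation ring with valuation \<open>v\<close>, and the residue
  field does not grow from \<open>R\<close> to \<open>V\<close>.  An element of a fractional ideal can therefore be
  approximated by elements of a submodule with the same set of values, and the length of \<open>J / L\<close> is
  the number of values of \<open>J\<close> that \<open>L\<close> misses (\<open>eq_by_values\<close>, \<open>len_eq_vlen\<close>).  Additivity of
  length, its invariance under scaling and \<open>l(J / xJ) = v(x)\<close> become statements about sets of
  integers.  All of this rests on the residue property and on the conductor being nonzero; both pass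
  to the rings between \<open>R\<close> and \<open>V\<close>, in particular to \<open>\<Lambda>\<close>.

  Two further ingredients are general.  Applying \<open>\<omega> : _\<close> to chains of submodules reverses them, so
  \<open>l((\<omega> : L) / (\<omega> : J)) = l(J / L)\<close> (\<open>vlen_dual\<close>).  An element \<open>x\<close> of least value in \<open>I\<close> is a
  minimal reduction, because the modules \<open>x\<^sup>-\<^sup>n I\<^sup>n\<close> increase inside \<open>V\<close> and hence become
  stationary; their limit is \<open>\<Lambda>\<close>, and \<open>I\<^sup>n = x\<^sup>n \<Lambda>\<close> for \<open>n \<ge> \<nu>\<close> (\<open>blowup_properties\<close>).

  For the formula put \<open>J = R : \<Lambda>\<close>.  Since \<open>I\<close> is not principal, \<open>\<Lambda> \<noteq> R\<close>, so \<open>z\<Lambda>\<close> lies in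
  \<open>\<mm>\<close> for every \<open>z\<close> in \<open>J\<close>; as \<open>\<mm>\<omega> = \<mm>\<close>, it follows that \<open>\<omega>J = J\<close>
  (\<open>overring_conductor_stable\<close>).  Hence \<open>\<Lambda>\<^sup>*\<^sup>* = R : J = \<omega> : J\<close>, and duality gives
  \<open>l(\<Lambda>\<^sup>*\<^sup>* / R) = l(\<omega> / R) + l(R / J)\<close>, where \<open>l(\<omega> / R) = r - 1\<close>.  Together with
  \<open>l(\<Lambda> / I\<^sup>\<nu>) = e\<nu>\<close> and the chain \<open>I\<^sup>\<nu> \<subseteq> J \<subseteq> R \<subseteq> \<Lambda> \<subseteq> \<Lambda>\<^sup>*\<^sup>*\<close> this is the formula
  (\<open>genus_formula\<close>).

  Hence \<open>2\<rho> = e\<nu> + r - 1\<close> forces \<open>J = I\<^sup>\<nu>\<close>; conversely \<open>J = x\<^sup>\<nu> \<Lambda>\<close> makes \<open>\<Lambda>\<close> reflexive, so both error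
  terms vanish.  The condition on Gorensteinness comes from the fact that \<open>\<omega> : \<Lambda>\<close> is a canonical
  ideal of \<open>\<Lambda>\<close>: if \<open>\<Lambda>\<close> is Gorenstein, then \<open>\<omega> : \<Lambda> = z\<Lambda>\<close> for some \<open>z\<close> with
  \<open>v(z) = c - c\<^sub>\<Lambda>\<close>, and \<open>z\<Lambda>\<close> contains \<open>I\<^sup>\<nu> = x\<^sup>\<nu> \<Lambda>\<close>, with equality exactly if
  \<open>v(z) = v(x\<^sup>\<nu>) = e\<nu>\<close>.  The remaining conditions all say \<open>\<omega>\<Lambda> = \<Lambda>\<close>, after multiplication by
  a power of \<open>x\<close> or after dualising.
\<close>

section \<open>Subrings, submodules and products of a field in elementary terms\<close>

definition is_subring :: "'a::field set \<Rightarrow> bool" where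
  "is_subring S \<longleftrightarrow> 1 \<in> S \<and> (\<forall>x\<in>S. \<forall>y\<in>S. x - y \<in> S) \<and> (\<forall>x\<in>S. \<forall>y\<in>S. x * y \<in> S)"

definition is_submodule :: "'a::field set \<Rightarrow> 'a set \<Rightarrow> bool" where
  "is_submodule S N \<longleftrightarrow> 0 \<in> N \<and> (\<forall>x\<in>N. \<forall>y\<in>N. x + y \<in> N) \<and> (\<forall>a\<in>S. \<forall>x\<in>N. a * x \<in> N)"

lemma ring_on_simps [simp]:
  "carrier (ring_on S) = S" "\<one>\<^bsub>ring_on S\<^esub> = 1" "\<zero>\<^bsub>ring_on S\<^esub> = 0"
  "x \<otimes>\<^bsub>ring_on S\<^esub> y = x * y" "x \<oplus>\<^bsub>ring_on S\<^esub> y = x + y"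
  by (simp_all add: ring_of_type_algebra_def)

lemma ring_of_type_algebra_simps [simp]:
  "\<one>\<^bsub>ring_of_type_algebra\<^esub> = 1" "\<zero>\<^bsub>ring_of_type_algebra\<^esub> = 0"
  "x \<otimes>\<^bsub>ring_of_type_algebra\<^esub> y = x * y" "x \<oplus>\<^bsub>ring_of_type_algebra\<^esub> y = x + y"
  by (simp_all add: ring_of_type_algebra_def)

lemma is_subringD:
  assumes "is_subring S"
  shows "1 \<in> S" "0 \<in> S" "\<And>x y. x \<in> S \<Longrightarrow> y \<in> S \<Longrightarrow> x + y \<in> S"
    "\<And>x. x \<in> S \<Longrightarrow> - x \<in> S" "\<And>x y. x \<in> S \<Longrightarrow> y \<in> S \<Longrightarrow> x - y \<in> S"
    "\<And>x y. x \<in> S \<Longrightarrow> y \<in> S \<Longrightarrow> x * y \<in> S"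
proof -
  show *: "1 \<in> S" "\<And>x y. x \<in> S \<Longrightarrow> y \<in> S \<Longrightarrow> x - y \<in> S" "\<And>x y. x \<in> S \<Longrightarrow> y \<in> S \<Longrightarrow> x * y \<in> S"
    using assms by (auto simp: is_subring_def)
  show 0: "0 \<in> S" using *(2)[OF *(1) *(1)] by simp
  show m: "- x \<in> S" if "x \<in> S" for x using *(2)[OF 0 that] by simp
  show "x + y \<in> S" if "x \<in> S" "y \<in> S" for x y using *(2)[OF that(1) m[OF that(2)]] by simp
qed

lemma is_subring_pow: "is_subring S \<Longrightarrow> x \<in> S \<Longrightarrow> x ^ n \<in> S"
  by (induction n) (auto intro: is_subringD)

lemma cring_on_is_subring:
  assumes "cring (ring_on S)"
  shows "is_subring S"
proof -
  interpret cring "ring_on S" by fact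
  have "x - y \<in> S" if "x \<in> S" "y \<in> S" for x y
  proof -
    have "\<ominus>\<^bsub>ring_on S\<^esub> y \<in> S" "y + \<ominus>\<^bsub>ring_on S\<^esub> y = 0"
      using that r_neg[of y] a_inv_closed[of y] by simp_all
    hence "- y \<in> S" by (simp add: add_eq_0_iff)
    thus ?thesis using a_closed[of x "- y"] that by simp
  qed
  thus ?thesis using one_closed m_closed by (auto simp: is_subring_def)
qed

lemma subring_is_subring:
  fixes S :: "'a::field set"
  assumes "subring S ring_of_type_algebra"
  shows "is_subring S"
proof -
  interpret K: cring "ring_of_type_algebra :: 'a ring" by (rule cring_from_type_algebra)
  have "cring (ring_on S)"
    using K.subcring_iff[of S] assms K.subcringI'[OF assms]
    by (simp add: ring_of_type_algebra_def)
  thus ?thesis by (rule cring_on_is_subring)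
qed

lemma is_submoduleD:
  assumes "is_submodule S N"
  shows "0 \<in> N" "\<And>x y. x \<in> N \<Longrightarrow> y \<in> N \<Longrightarrow> x + y \<in> N"
    "\<And>a x. a \<in> S \<Longrightarrow> x \<in> N \<Longrightarrow> a * x \<in> N"
  using assms by (auto simp: is_submodule_def)

lemma is_submodule_diff:
  assumes "is_subring S" "is_submodule S N" "x \<in> N" "y \<in> N"
  shows "x - y \<in> N"
proof -
  have "- 1 \<in> S" using is_subringD(1,4)[OF assms(1)] by blast
  hence "x + (- 1) * y \<in> N" using is_submoduleD[OF assms(2)] assms(3,4) by blast
  thus ?thesis by simp
qed

lemma is_submodule_self: "is_subring S \<Longrightarrow> is_submodule S S"
  by (auto simp: is_submodule_def intro: is_subringD)

lemma is_submodule_antimono: "S \<subseteq> S' \<Longrightarrow> is_submodule S' N \<Longrightarrow> is_submodule S N"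
  by (auto simp: is_submodule_def)

lemma submodule_iff:
  assumes "is_subring S"
  shows "submodule N (ring_on S) field_module \<longleftrightarrow> is_submodule S N"
proof
  assume "submodule N (ring_on S) field_module"
  then interpret submodule N "ring_on S" field_module .
  show "is_submodule S N"
    using m_closed one_closed smult_closed by (auto simp: is_submodule_def field_module_def)
next
  assume N: "is_submodule S N"
  have inv: "inv\<^bsub>add_monoid field_module\<^esub> x = - x" for x :: 'a
    by (rule group.inv_equality[where G = "add_monoid field_module"])
      (auto simp: field_module_def intro!: groupI add.left_inverse exI[of _ "- _"] simp: add.assoc)
  show "submodule N (ring_on S) field_module"
  proof (unfold_locales, goal_cases)
    case (4 x)
    thus ?case using is_submodule_diff[OF assms N is_submoduleD(1)[OF N], of x] by (simp add: inv)
  qed (use N in \<open>auto simp: is_submodule_def field_module_def\<close>)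
qed

lemma fprod_memI: "i \<in> J \<Longrightarrow> j \<in> L \<Longrightarrow> i * j \<in> fprod J L"
  using ideal_prod.prod[of i J j L ring_of_type_algebra] by (simp add: ring_of_type_algebra_def)

lemma fprod_add: "x \<in> fprod J L \<Longrightarrow> y \<in> fprod J L \<Longrightarrow> x + y \<in> fprod J L"
  using ideal_prod.sum[of x ring_of_type_algebra J L y] by (simp add: ring_of_type_algebra_def)

text \<open>
  The product is the additive closure of the set of products, so membership in an additively closed
  set has to be tested on products only.  The identities for products and colons below rest on this.
\<close>

lemma fprod_subset:
  assumes "\<And>i j. i \<in> J \<Longrightarrow> j \<in> L \<Longrightarrow> i * j \<in> N" "\<And>x y. x \<in> N \<Longrightarrow> y \<in> N \<Longrightarrow> x + y \<in> N"
  shows "fprod J L \<subseteq> N"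
proof
  fix z assume "z \<in> fprod J L"
  thus "z \<in> N"
    by (induction rule: ideal_prod.induct) (simp_all add: ring_of_type_algebra_def assms)
qed

lemma fprod_mono: "J \<subseteq> J' \<Longrightarrow> L \<subseteq> L' \<Longrightarrow> fprod J L \<subseteq> fprod J' L'"
  by (rule fprod_subset) (auto intro: fprod_memI fprod_add)

lemma fprod_commute: "fprod J L = fprod L J"
proof -
  have "fprod A B \<subseteq> fprod B A" for A B :: "'a set"
    by (rule fprod_subset) (metis fprod_memI mult.commute, rule fprod_add)
  thus ?thesis by blast
qed

lemma fprod_assoc: "fprod (fprod A B) C = fprod A (fprod B C)"
proof -
  have le: "fprod (fprod A B) C \<subseteq> fprod A (fprod B C)" for A B C :: "'a set"
  proof (rule fprod_subset)
    fix x c assume "x \<in> fprod A B" "c \<in> C"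
    moreover have "fprod A B \<subseteq> {x. x * c \<in> fprod A (fprod B C)}" if "c \<in> C"
      using that
      by (intro fprod_subset) (auto simp: mult.assoc distrib_right intro: fprod_memI fprod_add)
    ultimately show "x * c \<in> fprod A (fprod B C)" by blast
  qed (rule fprod_add)
  have "fprod A (fprod B C) = fprod (fprod C B) A" by (metis fprod_commute)
  also have "\<dots> \<subseteq> fprod C (fprod B A)" by (rule le)
  also have "\<dots> = fprod (fprod A B) C" by (metis fprod_commute)
  finally show ?thesis using le by blast
qed

lemma fprod_scale: "fprod ((*) x ` J) L = (*) x ` fprod J L"
proof
  show "fprod ((*) x ` J) L \<subseteq> (*) x ` fprod J L"
  proof (rule fprod_subset)
    fix i j assume "i \<in> (*) x ` J" "j \<in> L"
    thus "i * j \<in> (*) x ` fprod J L" by (auto simp: mult.assoc intro!: imageI fprod_memI)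
  next
    fix a b assume "a \<in> (*) x ` fprod J L" "b \<in> (*) x ` fprod J L"
    thus "a + b \<in> (*) x ` fprod J L"
      by (auto simp: image_iff distrib_left [symmetric] intro: fprod_add)
  qed
  have "fprod J L \<subseteq> {y. x * y \<in> fprod ((*) x ` J) L}"
  proof (rule fprod_subset)
    fix i j assume "i \<in> J" "j \<in> L"
    thus "i * j \<in> {y. x * y \<in> fprod ((*) x ` J) L}"
      using fprod_memI[of "x * i" "(*) x ` J" j L] by (auto simp: mult.assoc)
  qed (simp add: distrib_left fprod_add)
  thus "(*) x ` fprod J L \<subseteq> fprod ((*) x ` J) L" by blast
qed

lemma fprod_scale_right: "fprod J ((*) x ` L) = (*) x ` fprod J L"
  by (metis fprod_commute fprod_scale)

lemma fprod_submodule: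
  assumes "is_submodule S J" "L \<noteq> {}"
  shows "is_submodule S (fprod J L)"
proof -
  obtain l where "l \<in> L" using assms(2) by blast
  hence "0 \<in> fprod J L" using fprod_memI[of 0 J l L] is_submoduleD(1)[OF assms(1)] by simp
  moreover have "fprod J L \<subseteq> {x. a * x \<in> fprod J L}" if "a \<in> S" for a
    using that by (intro fprod_subset)
      (auto simp: distrib_left mult.assoc[symmetric] intro: fprod_memI fprod_add is_submoduleD[OF assms(1)])
  ultimately show ?thesis by (auto simp: is_submodule_def intro: fprod_add)
qed

lemma fprod_ring_left:
  assumes "is_subring S" "is_submodule S J"
  shows "fprod S J = J"
proof
  show "fprod S J \<subseteq> J" by (rule fprod_subset) (auto intro: is_submoduleD[OF assms(2)])
  show "J \<subseteq> fprod S J"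
    using fprod_memI[OF is_subringD(1)[OF assms(1)], of _ J] by auto
qed

lemma fprod_square:
  assumes "is_subring S"
  shows "fprod S S = S"
  using fprod_ring_left[OF assms is_submodule_self[OF assms]] .

lemma colon_mono: "J \<subseteq> J' \<Longrightarrow> L' \<subseteq> L \<Longrightarrow> colon J L \<subseteq> colon J' L'"
  by (auto simp: colon_def)

text \<open>
  The adjunction between products and colons; every iterated colon below is computed with it.
\<close>

lemma colon_fprod:
  assumes "is_submodule S N"
  shows "colon N (fprod J L) = colon (colon N J) L"
proof
  show "colon N (fprod J L) \<subseteq> colon (colon N J) L"
  proof
    fix y assume y: "y \<in> colon N (fprod J L)"
    show "y \<in> colon (colon N J) L"
      unfolding colon_def
    proof (intro CollectI ballI)
      fix l j assume "l \<in> L" "j \<in> J"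
      hence "y * (j * l) \<in> N" using y fprod_memI[of j J l L] by (auto simp: colon_def)
      thus "y * l * j \<in> N" by (simp add: ac_simps)
    qed
  qed
  show "colon (colon N J) L \<subseteq> colon N (fprod J L)"
  proof
    fix y assume y: "y \<in> colon (colon N J) L"
    have "fprod J L \<subseteq> {z. y * z \<in> N}"
    proof (rule fprod_subset)
      fix j l assume "j \<in> J" "l \<in> L"
      hence "y * l * j \<in> N" using y by (auto simp: colon_def)
      thus "j * l \<in> {z. y * z \<in> N}" by (simp add: ac_simps)
    qed (simp add: distrib_left is_submoduleD(2)[OF assms])
    thus "y \<in> colon N (fprod J L)" by (auto simp: colon_def)
  qed
qed

lemma colon_submodule:
  assumes "is_submodule S N"
  shows "is_submodule S (colon N J)"
  using is_submoduleD[OF assms] by (auto simp: is_submodule_def colon_def distrib_right mult.assoc)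

lemma colon_submodule_right:
  assumes "is_submodule S N" "is_submodule T J"
  shows "is_submodule T (colon N J)"
proof -
  have "a * x * z \<in> N" if "a \<in> T" "\<forall>z\<in>J. x * z \<in> N" "z \<in> J" for a x z
  proof -
    have "x * (a * z) \<in> N" using that is_submoduleD(3)[OF assms(2)] by blast
    thus ?thesis by (simp add: ac_simps)
  qed
  thus ?thesis using is_submoduleD[OF assms(1)]
    by (auto simp: is_submodule_def colon_def distrib_right)
qed

lemma colon_ring_self:
  assumes "is_subring S" "is_submodule S N"
  shows "colon N S = N"
  using is_subringD(1)[OF assms(1)] is_submoduleD(3)[OF assms(2)]
  by (force simp: colon_def mult.commute)

lemma mem_scale_iff:
  fixes x :: "'a::field"
  assumes "x \<noteq> 0"
  shows "y \<in> (*) x ` J \<longleftrightarrow> y / x \<in> J"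
  using assms by (auto simp: image_iff intro!: bexI[of _ "y / x"])

lemma colon_scale_left:
  assumes "x \<noteq> 0"
  shows "colon ((*) x ` J) L = (*) x ` colon J L"
  using assms by (auto simp: mem_scale_iff colon_def)

lemma colon_scale_right:
  assumes "x \<noteq> 0"
  shows "colon J ((*) x ` L) = (*) (inverse x) ` colon J L"
proof -
  have "y * (x * z) = y / inverse x * z" for y z using assms by (simp add: field_simps)
  thus ?thesis using assms by (auto simp: colon_def mem_scale_iff[of "inverse x"])
qed

lemma scale_scale: "(*) x ` (*) y ` J = (*) (x * y) ` (J :: 'a::field set)"
  by (auto simp: image_image mult.assoc)

lemma scale_inject:
  fixes x :: "'a::field"
  assumes "x \<noteq> 0"
  shows "(*) x ` J = (*) x ` L \<longleftrightarrow> J = L" "(*) x ` J \<subseteq> (*) x ` L \<longleftrightarrow> J \<subseteq> L"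
  using assms by (auto simp: inj_image_eq_iff inj_image_subset_iff inj_on_def)

lemma scale_submodule: "is_submodule S J \<Longrightarrow> is_submodule S ((*) x ` J)"
  by (auto simp: is_submodule_def image_iff distrib_left[symmetric] mult.left_commute)

lemma fpow_submodule:
  assumes "is_subring R" "is_submodule R I"
  shows "is_submodule R (fpow R I n)"
  by (induction n)
    (auto intro!: is_submodule_self fprod_submodule assms dest: is_submoduleD(1))

lemma fpow_add:
  assumes "is_subring R" "is_submodule R I"
  shows "fpow R I (m + n) = fprod (fpow R I m) (fpow R I n)"
proof (induction m)
  case 0
  show ?case using fprod_ring_left[OF assms(1) fpow_submodule[OF assms]] by simp
qed (simp add: fprod_assoc)

section \<open>Length over a branch is a count of values\<close>

text \<open>
  The value \<open>v 0\<close> is arbitrary; \<open>val_ge\<close> contains \<open>0\<close> by definition and \<open>vals\<close> leaves it out.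
\<close>

locale discrete_valuation =
  fixes v :: "'a::field \<Rightarrow> int"
  assumes v_mult: "x \<noteq> 0 \<Longrightarrow> y \<noteq> 0 \<Longrightarrow> v (x * y) = v x + v y"
    and v_add: "x \<noteq> 0 \<Longrightarrow> y \<noteq> 0 \<Longrightarrow> x + y \<noteq> 0 \<Longrightarrow> min (v x) (v y) \<le> v (x + y)"
    and uniformizer: "\<exists>t. t \<noteq> 0 \<and> v t = 1"
begin

definition val_ge :: "int \<Rightarrow> 'a set" where
  "val_ge n = {x. x = 0 \<or> n \<le> v x}"

definition vals :: "'a set \<Rightarrow> int set" where
  "vals N = v ` (N - {0})"

definition is_fractional :: "'a set \<Rightarrow> 'a set \<Rightarrow> bool" where
  "is_fractional S N \<longleftrightarrow> is_submodule S N \<and> N \<noteq> {0} \<and> (\<exists>n. N \<subseteq> val_ge n)"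

text \<open>
  By \<open>len_eq_vlen\<close> this count is the length of \<open>J / L\<close> when \<open>L \<subseteq> J\<close> are fractional ideals.
\<close>

definition vlen :: "'a set \<Rightarrow> 'a set \<Rightarrow> nat" where
  "vlen J L = card (vals J - vals L)"

lemma v_one [simp]: "v 1 = 0"
  using v_mult[of 1 1] by simp

lemma v_minus [simp]: "v (- x) = v x"
proof (cases "x = 0")
  case False
  have "v (- 1) = 0" using v_mult[of "- 1" "- 1"] by simp
  thus ?thesis using v_mult[of "- 1" x] False by simp
qed simp

lemma v_inverse: "x \<noteq> 0 \<Longrightarrow> v (inverse x) = - v x"
  using v_mult[of x "inverse x"] by simp

lemma v_divide: "x \<noteq> 0 \<Longrightarrow> y \<noteq> 0 \<Longrightarrow> v (x / y) = v x - v y"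
  by (simp add: divide_inverse v_mult v_inverse)

lemma v_power: "x \<noteq> 0 \<Longrightarrow> v (x ^ n) = int n * v x"
  by (induction n) (simp_all add: v_mult algebra_simps)

lemma v_add_dominant:
  assumes "x \<noteq> 0" "y = 0 \<or> v x < v y"
  shows "x + y \<noteq> 0 \<and> v (x + y) = v x"
proof (cases "y = 0")
  case False
  hence less: "v x < v y" using assms by simp
  have nz: "x + y \<noteq> 0"
  proof
    assume "x + y = 0"
    hence "x = - y" by (simp add: eq_neg_iff_add_eq_0)
    thus False using less by simp
  qed
  have "min (v (x + y)) (v (- y)) \<le> v (x + y + - y)"
    by (rule v_add) (use nz False assms(1) in auto)
  thus ?thesis using v_add[OF assms(1) False nz] less nz by simp
qed (use assms in simp)

lemma ex_value: "\<exists>x. x \<noteq> 0 \<and> v x = n"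
proof -
  obtain t where t: "t \<noteq> 0" "v t = 1" using uniformizer by blast
  show ?thesis
  proof (cases "n \<ge> 0")
    case True
    thus ?thesis using t v_power[of t "nat n"] by (intro exI[of _ "t ^ nat n"]) simp
  next
    case False
    have "v (inverse (t ^ nat (- n))) = n"
      using False t v_power[of t "nat (- n)"] v_inverse[of "t ^ nat (- n)"] by simp
    thus ?thesis using t(1) by (intro exI[of _ "inverse (t ^ nat (- n))"]) simp
  qed
qed

lemma val_ge_add: "x \<in> val_ge n \<Longrightarrow> y \<in> val_ge n \<Longrightarrow> x + y \<in> val_ge n"
  using v_add[of x y] by (cases "x = 0"; cases "y = 0"; cases "x + y = 0") (auto simp: val_ge_def)

lemma val_ge_mult: "x \<in> val_ge m \<Longrightarrow> y \<in> val_ge n \<Longrightarrow> x * y \<in> val_ge (m + n)"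
  by (cases "x = 0"; cases "y = 0") (auto simp: val_ge_def v_mult)

lemma val_ge_mono: "m \<le> n \<Longrightarrow> val_ge n \<subseteq> val_ge m"
  by (auto simp: val_ge_def)

lemma val_ge_scale: "x \<noteq> 0 \<Longrightarrow> (*) x ` val_ge n = val_ge (v x + n)"
proof -
  assume x: "x \<noteq> 0"
  show ?thesis by (rule Set.set_eqI) (use x in \<open>auto simp: mem_scale_iff val_ge_def v_divide\<close>)
qed

lemma val_ge_is_subring: "is_subring (val_ge 0)"
proof -
  have "x - y \<in> val_ge 0" if "x \<in> val_ge 0" "y \<in> val_ge 0" for x y
    using val_ge_add[of x 0 "- y"] that by (simp add: val_ge_def)
  moreover have "x * y \<in> val_ge 0" if "x \<in> val_ge 0" "y \<in> val_ge 0" for x y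
    using val_ge_mult[OF that] by simp
  moreover have "1 \<in> val_ge 0" by (simp add: val_ge_def)
  ultimately show ?thesis by (simp add: is_subring_def)
qed

lemma colon_val_ge_subset:
  assumes "S \<subseteq> val_ge 0"
  shows "colon S (val_ge 0) \<subseteq> val_ge 0"
proof
  fix y assume "y \<in> colon S (val_ge 0)"
  hence "y * 1 \<in> S" using is_subringD(1)[OF val_ge_is_subring] unfolding colon_def by blast
  thus "y \<in> val_ge 0" using assms by auto
qed

lemma val_ge_submodule: "is_submodule (val_ge 0) (val_ge n)"
proof -
  have "a * x \<in> val_ge n" if "a \<in> val_ge 0" "x \<in> val_ge n" for a x
    using val_ge_mult[OF that] by simp
  moreover have "0 \<in> val_ge n" by (simp add: val_ge_def)
  ultimately show ?thesis by (simp add: is_submodule_def val_ge_add)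
qed

lemma val_ge_nonzero: "val_ge n \<noteq> {0}"
  using ex_value[of n] by (auto simp: val_ge_def)

lemma vals_val_ge: "vals (val_ge n) = {n..}"
proof
  show "vals (val_ge n) \<subseteq> {n..}" by (auto simp: vals_def val_ge_def)
  show "{n..} \<subseteq> vals (val_ge n)"
  proof
    fix k assume "k \<in> {n..}"
    moreover obtain x where "x \<noteq> 0" "v x = k" using ex_value by blast
    ultimately show "k \<in> vals (val_ge n)" by (auto simp: vals_def val_ge_def)
  qed
qed

lemma vals_mono: "L \<subseteq> J \<Longrightarrow> vals L \<subseteq> vals J"
  by (auto simp: vals_def)

lemma vals_scale: "x \<noteq> 0 \<Longrightarrow> vals ((*) x ` J) = (+) (v x) ` vals J"
  by (auto simp: vals_def v_mult image_image intro!: image_eqI)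

lemma is_fractionalD:
  assumes "is_fractional S N"
  shows "is_submodule S N" "\<exists>x\<in>N. x \<noteq> 0" "\<exists>n. N \<subseteq> val_ge n"
  using assms by (auto simp: is_fractional_def dest: is_submoduleD(1))

lemma is_fractional_antimono:
  "S \<subseteq> T \<Longrightarrow> is_fractional T N \<Longrightarrow> is_fractional S N"
  by (auto simp: is_fractional_def intro: is_submodule_antimono)

lemma ex_min_value:
  assumes "is_fractional S N"
  obtains x where "x \<in> N" "x \<noteq> 0" "\<And>y. y \<in> N \<Longrightarrow> y \<noteq> 0 \<Longrightarrow> v x \<le> v y"
proof -
  obtain n where n: "N \<subseteq> val_ge n" using is_fractionalD(3)[OF assms] by blast
  obtain z where z: "z \<in> N" "z \<noteq> 0" using is_fractionalD(2)[OF assms] by blast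
  obtain x where x: "x \<in> N - {0}" "\<forall>y. y \<in> N - {0} \<longrightarrow> nat (v x - n) \<le> nat (v y - n)"
    using ex_has_least_nat[of "\<lambda>y. y \<in> N - {0}" z "\<lambda>y. nat (v y - n)"] z by blast
  have "v x \<le> v y" if "y \<in> N" "y \<noteq> 0" for y
  proof -
    have "n \<le> v x" "n \<le> v y" using n x(1) that by (auto simp: val_ge_def)
    thus ?thesis using x(2)[rule_format, of y] that by auto
  qed
  thus ?thesis using x(1) that by blast
qed

lemma scale_fractional:
  assumes "is_fractional S J" "x \<noteq> 0"
  shows "is_fractional S ((*) x ` J)"
proof -
  obtain n where "J \<subseteq> val_ge n" using is_fractionalD(3)[OF assms(1)] by blast
  hence "(*) x ` J \<subseteq> val_ge (v x + n)"
    using image_mono[of J "val_ge n" "(*) x"] by (simp only: val_ge_scale[OF assms(2)])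
  moreover obtain z where z: "z \<in> J" "z \<noteq> 0" using is_fractionalD(2)[OF assms(1)] by blast
  have "x * z \<in> (*) x ` J" "x * z \<noteq> 0" using z assms(2) by simp_all
  hence "(*) x ` J \<noteq> {0}" by blast
  ultimately show ?thesis
    using scale_submodule[OF is_fractionalD(1)[OF assms(1)], of x]
    unfolding is_fractional_def by blast
qed

lemma fprod_fractional:
  assumes "is_fractional S J" "is_fractional S L"
  shows "is_fractional S (fprod J L)"
proof -
  obtain m n where mn: "J \<subseteq> val_ge m" "L \<subseteq> val_ge n"
    using is_fractionalD(3)[OF assms(1)] is_fractionalD(3)[OF assms(2)] by blast
  have "fprod J L \<subseteq> val_ge (m + n)"
  proof (rule fprod_subset)
    fix i j assume "i \<in> J" "j \<in> L"
    with mn show "i * j \<in> val_ge (m + n)" by (intro val_ge_mult) auto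
  qed (rule val_ge_add)
  moreover obtain a b where ab: "a \<in> J" "a \<noteq> 0" "b \<in> L" "b \<noteq> 0"
    using is_fractionalD(2)[OF assms(1)] is_fractionalD(2)[OF assms(2)] by blast
  have "a * b \<in> fprod J L" "a * b \<noteq> 0" using ab by (simp_all add: fprod_memI)
  hence "fprod J L \<noteq> {0}" by blast
  moreover have "L \<noteq> {}" using is_fractionalD(2)[OF assms(2)] by blast
  ultimately show ?thesis
    using fprod_submodule[OF is_fractionalD(1)[OF assms(1)], of L]
    unfolding is_fractional_def by blast
qed

end

text \<open>
  An analytically irreducible, residually rational local ring \<open>R\<close>, described through the valuation
  \<open>v\<close> of its normalisation \<open>val_ge 0\<close>.  In this form the properties visibly pass to every ring
  between \<open>R\<close> and the normalisation.
\<close>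

locale branch = discrete_valuation v for v :: "'a::field \<Rightarrow> int" +
  fixes R :: "'a set"
  assumes subring: "is_subring R"
    and R_le: "R \<subseteq> val_ge 0"
    and residual: "y \<in> val_ge 0 \<Longrightarrow> \<exists>a\<in>R. y - a \<in> val_ge 1"
    and conductor_exists: "\<exists>n. val_ge n \<subseteq> R"
begin

lemma val_ge_fractional: "is_fractional R (val_ge n)"
  using is_submodule_antimono[OF R_le val_ge_submodule] val_ge_nonzero
  by (auto simp: is_fractional_def)

lemma R_fractional: "is_fractional R R"
  using is_submodule_self[OF subring] R_le is_subringD(1)[OF subring]
  by (auto simp: is_fractional_def)

text \<open>
  If \<open>x \<noteq> 0\<close> lies in \<open>N\<close>, then so does \<open>x\<close> times the conductor.
\<close>

lemma val_ge_subset_fractional: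
  assumes "is_fractional R N"
  shows "\<exists>n. val_ge n \<subseteq> N"
proof -
  obtain x where x: "x \<in> N" "x \<noteq> 0" using is_fractionalD(2)[OF assms] by blast
  obtain n where n: "val_ge n \<subseteq> R" using conductor_exists by blast
  have "val_ge (v x + n) \<subseteq> N"
  proof
    fix y assume "y \<in> val_ge (v x + n)"
    hence "y / x \<in> R" using n x mem_scale_iff[of x y] val_ge_scale[of x n] by blast
    hence "y / x * x \<in> N" using is_submoduleD(3)[OF is_fractionalD(1)[OF assms]] x by blast
    thus "y \<in> N" using x by simp
  qed
  thus ?thesis by blast
qed

lemma colon_fractional:
  assumes "is_fractional R J" "is_fractional R L"
  shows "is_fractional R (colon J L)"
proof -
  obtain m where m: "val_ge m \<subseteq> J" using val_ge_subset_fractional[OF assms(1)] by blast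
  obtain n where n: "L \<subseteq> val_ge n" using is_fractionalD(3)[OF assms(2)] by blast
  obtain k where k: "J \<subseteq> val_ge k" using is_fractionalD(3)[OF assms(1)] by blast
  obtain z where z: "z \<in> L" "z \<noteq> 0" using is_fractionalD(2)[OF assms(2)] by blast
  have "val_ge (m - n) \<subseteq> colon J L"
    using val_ge_mult[of _ "m - n" _ n] m n by (auto simp: colon_def)
  moreover obtain x where "x \<noteq> 0" "v x = m - n" using ex_value by blast
  ultimately have "x \<in> colon J L" "x \<noteq> 0" by (auto simp: val_ge_def)
  hence "colon J L \<noteq> {0}" by blast
  moreover have "colon J L \<subseteq> val_ge (k - v z)"
  proof
    fix y assume "y \<in> colon J L"
    hence "y * z \<in> val_ge k" using k z by (auto simp: colon_def)
    thus "y \<in> val_ge (k - v z)" using z v_mult[of y z] by (cases "y = 0") (auto simp: val_ge_def)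
  qed
  ultimately show ?thesis
    using colon_submodule[OF is_fractionalD(1)[OF assms(1)]] by (auto simp: is_fractional_def)
qed

lemma fpow_fractional:
  assumes "is_fractional R I"
  shows "is_fractional R (fpow R I n)"
  by (induction n) (simp_all add: R_fractional fprod_fractional assms)

text \<open>
  A denominator bounds the values from below.  Conversely, an element of large enough value moves a
  set with bounded values into the conductor.
\<close>

lemma fractional_iff: "fractional_ideal R N \<longleftrightarrow> is_fractional R N"
proof
  assume N: "fractional_ideal R N"
  then obtain d where d: "d \<in> R" "d \<noteq> 0" "(*) d ` N \<subseteq> R" by (auto simp: fractional_ideal_def)
  have "N \<subseteq> val_ge (- v d)"
  proof
    fix y assume "y \<in> N"
    hence "d * y \<in> val_ge 0" using d R_le by blast
    thus "y \<in> val_ge (- v d)" using d v_mult[of d y] by (cases "y = 0") (auto simp: val_ge_def)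
  qed
  thus "is_fractional R N"
    using N submodule_iff[OF subring] by (auto simp: fractional_ideal_def is_fractional_def)
next
  assume N: "is_fractional R N"
  obtain n where n: "N \<subseteq> val_ge n" using is_fractionalD(3)[OF N] by blast
  obtain m where m: "val_ge m \<subseteq> R" using conductor_exists by blast
  obtain d where d: "d \<noteq> 0" "v d = max m (m - n)" using ex_value by blast
  have "(*) d ` N \<subseteq> val_ge m"
  proof -
    have "(*) d ` N \<subseteq> val_ge (v d + n)"
      using image_mono[OF n, of "(*) d"] by (simp add: val_ge_scale[OF d(1)])
    also have "\<dots> \<subseteq> val_ge m" using d(2) by (intro val_ge_mono) simp
    finally show ?thesis .
  qed
  moreover have "d \<in> R" using d m by (auto simp: val_ge_def)
  ultimately show "fractional_ideal R N"
    using N d(1) m submodule_iff[OF subring]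
    unfolding fractional_ideal_def is_fractional_def by blast
qed

text \<open>
  Given \<open>y\<close> in \<open>J\<close>, choose \<open>z\<close> in \<open>L\<close> of the same value.  Residual rationality provides \<open>a\<close> in
  \<open>R\<close> with the residue of \<open>y / z\<close>, and \<open>y - a z\<close> has larger value.  After finitely many steps the
  value is so large that the remainder lies in \<open>L\<close>.
\<close>

lemma eq_by_values:
  assumes J: "is_fractional R J" and L: "is_fractional R L"
    and le: "L \<subseteq> J" and vals: "vals J \<subseteq> vals L"
  shows "J = L"
proof -
  note Jm = is_fractionalD(1)[OF J] and Lm = is_fractionalD(1)[OF L]
  obtain m where m: "val_ge m \<subseteq> L" using val_ge_subset_fractional[OF L] by blast
  have "y \<in> L" if "y \<in> J" for y
    using that
  proof (induction "nat (m - v y)" arbitrary: y rule: less_induct)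
    case less
    show ?case
    proof (cases "y = 0 \<or> m \<le> v y")
      case True
      thus ?thesis using m by (auto simp: val_ge_def)
    next
      case False
      hence "v y \<in> vals L" using vals less.prems by (auto simp: vals_def)
      then obtain z where z: "z \<in> L" "z \<noteq> 0" "v z = v y" unfolding vals_def by fastforce
      have "y / z \<in> val_ge 0" using False z by (simp add: val_ge_def v_divide)
      then obtain a where a: "a \<in> R" "y / z - a \<in> val_ge 1" using residual by blast
      have az: "a * z \<in> L" using is_submoduleD(3)[OF Lm] a z by blast
      have eq: "y - a * z = z * (y / z - a)" using z by (simp add: field_simps)
      have "y - a * z \<in> L"
      proof (cases "y - a * z = 0")
        case True
        thus ?thesis using is_submoduleD(1)[OF Lm] by simp
      next
        case ne: False
        hence nz: "y / z - a \<noteq> 0" using eq by auto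
        have "v (y - a * z) = v z + v (y / z - a)" unfolding eq by (rule v_mult[OF z(2) nz])
        hence "v y < v (y - a * z)" using a(2) nz z(3) by (simp add: val_ge_def)
        moreover have "y - a * z \<in> J"
          using is_submodule_diff[OF subring Jm less.prems] az le by blast
        ultimately show ?thesis using less.hyps False by simp
      qed
      from is_submoduleD(2)[OF Lm this az] show ?thesis by simp
    qed
  qed
  thus ?thesis using le by blast
qed

text \<open>
  Multiplication by \<open>u\<close> does not change values, so \<open>u R = R\<close>.  In particular \<open>R\<close> is local.
\<close>

lemma inverse_unit:
  assumes "u \<in> R" "u \<noteq> 0" "v u = 0"
  shows "inverse u \<in> R"
proof -
  have "(*) u ` R \<subseteq> R" using assms(1) is_subringD(6)[OF subring] by auto
  hence "R = (*) u ` R"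
    using eq_by_values[OF R_fractional scale_fractional[OF R_fractional assms(2)]]
      vals_scale[OF assms(2), of R] assms(3) by simp
  hence "1 \<in> (*) u ` R" using is_subringD(1)[OF subring] by simp
  thus ?thesis using mem_scale_iff[OF assms(2)] by (simp add: divide_inverse)
qed

lemma scale_unit_R:
  assumes "u \<in> R" "u \<noteq> 0" "v u = 0"
  shows "(*) u ` R = R"
  using mem_scale_iff[OF assms(2), of _ R] is_subringD(6)[OF subring] inverse_unit[OF assms] assms(1,2)
  by (auto simp: divide_inverse)

lemma finite_vals_diff:
  assumes "is_fractional R J" "is_fractional R L"
  shows "finite (vals J - vals L)"
proof -
  obtain m where m: "val_ge m \<subseteq> L" using val_ge_subset_fractional[OF assms(2)] by blast
  obtain n where n: "J \<subseteq> val_ge n" using is_fractionalD(3)[OF assms(1)] by blast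
  have "vals J - vals L \<subseteq> {n..<m}"
    using vals_mono[OF m] vals_mono[OF n] vals_val_ge by fastforce
  thus ?thesis by (rule finite_subset) simp
qed

lemma vlen_add:
  assumes "is_fractional R J" "is_fractional R L" "L \<subseteq> M" "M \<subseteq> J"
  shows "vlen J L = vlen J M + vlen M L"
proof -
  have le: "vals L \<subseteq> vals M" "vals M \<subseteq> vals J"
    using vals_mono[OF assms(3)] vals_mono[OF assms(4)] .
  have eq: "vals J - vals L = (vals J - vals M) \<union> (vals M - vals L)" using le by blast
  have fin: "finite (vals J - vals L)" using finite_vals_diff[OF assms(1,2)] .
  have "finite (vals J - vals M)" "finite (vals M - vals L)"
    by (rule finite_subset[OF _ fin], use le in blast)+
  thus ?thesis unfolding vlen_def eq by (intro card_Un_disjoint) blast+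
qed

lemma vlen_eq_0_iff:
  assumes "is_fractional R J" "is_fractional R L" "L \<subseteq> J"
  shows "vlen J L = 0 \<longleftrightarrow> J = L"
proof
  assume "vlen J L = 0"
  hence "vals J \<subseteq> vals L" using finite_vals_diff[OF assms(1,2)] by (simp add: vlen_def)
  thus "J = L" by (rule eq_by_values[OF assms])
qed (simp add: vlen_def)

lemma vlen_scale: "x \<noteq> 0 \<Longrightarrow> vlen ((*) x ` J) ((*) x ` L) = vlen J L"
proof -
  assume "x \<noteq> 0"
  hence "vals ((*) x ` J) - vals ((*) x ` L) = (+) (v x) ` (vals J - vals L)"
    using image_set_diff[OF inj_on_add, of "v x" "vals J" "vals L"] by (simp add: vals_scale)
  thus ?thesis by (simp add: vlen_def card_image)
qed

text \<open>
  The length of \<open>J / xJ\<close> does not depend on \<open>J\<close>: enlarge \<open>J\<close> to some \<open>val_ge n\<close> and compare the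
  two ways from \<open>val_ge n\<close> down to \<open>xJ\<close>.  For \<open>val_ge n\<close> itself the missing values are
  \<open>n, \<dots>, n + v x - 1\<close>.
\<close>

lemma vlen_scale_self:
  assumes J: "is_fractional R J" and x: "x \<noteq> 0" and le: "(*) x ` J \<subseteq> J"
  shows "int (vlen J ((*) x ` J)) = v x"
proof -
  \<comment> \<open>If \<open>v x < 0\<close>, then \<open>x\<close> times an element of least value would have smaller value.\<close>
  have pos: "0 \<le> v x"
  proof -
    obtain z where z: "z \<in> J" "z \<noteq> 0" "\<And>y. y \<in> J \<Longrightarrow> y \<noteq> 0 \<Longrightarrow> v z \<le> v y"
      using ex_min_value[OF J] by blast
    have "x * z \<in> J" using z(1) le by blast
    hence "v z \<le> v (x * z)" using z(2) x by (intro z(3)) simp_all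
    thus ?thesis using v_mult[OF x z(2)] by simp
  qed
  obtain n where n: "J \<subseteq> val_ge n" using is_fractionalD(3)[OF J] by blast
  note xJ = scale_fractional[OF J x]
  have xn: "(*) x ` val_ge n \<subseteq> val_ge n" "(*) x ` J \<subseteq> (*) x ` val_ge n"
    using val_ge_mono[of n "v x + n"] pos image_mono[OF n, of "(*) x"]
    by (simp_all add: val_ge_scale[OF x])
  have "{n..} - {v x + n..} = {n..<n + v x}" by auto
  hence "int (vlen (val_ge n) ((*) x ` val_ge n)) = v x"
    using pos by (simp add: vlen_def val_ge_scale[OF x] vals_val_ge)
  moreover have "vlen (val_ge n) J + vlen J ((*) x ` J)
      = vlen (val_ge n) ((*) x ` val_ge n) + vlen ((*) x ` val_ge n) ((*) x ` J)"
    using vlen_add[OF val_ge_fractional xJ le n] vlen_add[OF val_ge_fractional xJ xn(2,1)] by simp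
  ultimately show ?thesis using vlen_scale[OF x] by simp
qed

lemma between_fractional:
  assumes "is_submodule R N" "L \<subseteq> N" "N \<subseteq> J" "is_fractional R L" "is_fractional R J"
  shows "is_fractional R N"
  using assms is_fractionalD(2)[OF assms(4)] is_fractionalD(3)[OF assms(5)]
  by (auto simp: is_fractional_def)

definition chain_between :: "'a set \<Rightarrow> 'a set \<Rightarrow> nat \<Rightarrow> (nat \<Rightarrow> 'a set) \<Rightarrow> bool" where
  "chain_between L J n N \<longleftrightarrow> (\<forall>i\<le>n. is_submodule R (N i) \<and> L \<subseteq> N i \<and> N i \<subseteq> J) \<and>
     (\<forall>i<n. N i \<subset> N (Suc i))"

lemma chain_length_le:
  assumes "is_fractional R J" "is_fractional R L" "chain_between L J n N"
  shows "n \<le> vlen J L"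
proof -
  have fr: "is_fractional R (N i)" if "i \<le> n" for i
    using assms that by (auto simp: chain_between_def intro: between_fractional)
  have bounds: "L \<subseteq> N i" "N i \<subseteq> J" if "i \<le> n" for i
    using assms(3) that by (auto simp: chain_between_def)
  have "i \<le> vlen (N i) L" if "i \<le> n" for i
    using that
  proof (induction i)
    case (Suc i)
    have lt: "N i \<subset> N (Suc i)" using assms(3) Suc.prems by (auto simp: chain_between_def)
    hence "vlen (N (Suc i)) (N i) \<noteq> 0" using vlen_eq_0_iff[OF fr fr] Suc.prems by auto
    moreover have "vlen (N (Suc i)) L = vlen (N (Suc i)) (N i) + vlen (N i) L"
      using vlen_add[OF fr[OF Suc.prems] assms(2), of "N i"] bounds(1)[of i] lt Suc.prems by auto
    ultimately show ?case using Suc by simp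
  qed simp
  from this[of n] vlen_add[OF assms(1,2), of "N n"] bounds[of n] show ?thesis by simp
qed

text \<open>
  Let \<open>n\<close> be the largest value of \<open>J\<close> that \<open>L\<close> misses.  Adding to \<open>L\<close> all elements of \<open>J\<close> of
  value at least \<open>n\<close> creates no other new value, so this is the first step of the chain.
\<close>

lemma chain_exists:
  assumes "is_fractional R J" "is_fractional R L" "L \<subseteq> J"
  shows "\<exists>N. chain_between L J (vlen J L) N"
  using assms(2,3)
proof (induction "vlen J L" arbitrary: L)
  case 0
  thus ?case using is_fractionalD(1)[OF 0(2)]
    by (intro exI[of _ "\<lambda>_. L"]) (simp add: chain_between_def)
next
  case (Suc k)
  note Lm = is_fractionalD(1)[OF Suc.prems(1)] and Jm = is_fractionalD(1)[OF assms(1)]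
  have fin: "finite (vals J - vals L)" using finite_vals_diff[OF assms(1) Suc.prems(1)] .
  have ne: "vals J - vals L \<noteq> {}"
    using Suc.hyps(2) unfolding vlen_def by (metis card.empty nat.distinct(1))
  define n where "n = Max (vals J - vals L)"
  have n: "n \<in> vals J - vals L" unfolding n_def using fin ne by (rule Max_in)
  have nmax: "k \<in> vals L" if "k \<in> vals J" "n < k" for k
    using that Max_ge[OF fin, of k] by (fastforce simp: n_def)
  define L' where "L' = {l + j | l j. l \<in> L \<and> j \<in> J \<inter> val_ge n}"
  have LL': "L \<subseteq> L'"
  proof
    fix l assume "l \<in> L"
    moreover have "l = l + 0" "0 \<in> J \<inter> val_ge n"
      using is_submoduleD(1)[OF Jm] by (simp_all add: val_ge_def)
    ultimately show "l \<in> L'" unfolding L'_def by blast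
  qed
  have L'J: "L' \<subseteq> J" using Suc.prems(2) is_submoduleD(2)[OF Jm] by (auto simp: L'_def)
  have "is_submodule R L'"
    unfolding is_submodule_def
  proof (intro conjI ballI)
    show "0 \<in> L'" using LL' is_submoduleD(1)[OF Lm] by blast
  next
    fix x y assume "x \<in> L'" "y \<in> L'"
    then obtain l j l' j' where *: "x = l + j" "y = l' + j'" "l \<in> L" "l' \<in> L"
      "j \<in> J \<inter> val_ge n" "j' \<in> J \<inter> val_ge n" by (auto simp: L'_def)
    have "x + y = (l + l') + (j + j')" by (simp add: *)
    moreover have "l + l' \<in> L" "j + j' \<in> J \<inter> val_ge n"
      using * is_submoduleD(2)[OF Lm] is_submoduleD(2)[OF Jm] val_ge_add by auto
    ultimately show "x + y \<in> L'" by (auto simp: L'_def)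
  next
    fix a x assume a: "a \<in> R" and "x \<in> L'"
    then obtain l j where *: "x = l + j" "l \<in> L" "j \<in> J \<inter> val_ge n" by (auto simp: L'_def)
    have "a * x = a * l + a * j" by (simp add: * distrib_left)
    moreover have "a * l \<in> L" "a * j \<in> J \<inter> val_ge n"
      using a * is_submoduleD(3)[OF Lm] is_submoduleD(3)[OF Jm]
        is_submoduleD(3)[OF is_fractionalD(1)[OF val_ge_fractional]] by auto
    ultimately show "a * x \<in> L'" by (auto simp: L'_def)
  qed
  hence L': "is_fractional R L'"
    using between_fractional[OF _ LL' L'J Suc.prems(1) assms(1)] by blast
  have "vals L' = insert n (vals L)"
  proof
    have "v (l + j) \<in> insert n (vals L)"
      if "l \<in> L" "j \<in> J" "j \<in> val_ge n" "l + j \<noteq> 0" for l j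
    proof (cases "l \<noteq> 0 \<and> v l < n")
      case True
      hence "v (l + j) = v l" using v_add_dominant[of l j] that(3) by (auto simp: val_ge_def)
      thus ?thesis using True that(1) by (auto simp: vals_def)
    next
      case False
      hence "l + j \<in> val_ge n" using that(3) by (intro val_ge_add) (auto simp: val_ge_def)
      hence "n < v (l + j) \<or> v (l + j) = n" using that(4) by (auto simp: val_ge_def)
      moreover have "v (l + j) \<in> vals J"
        using that Suc.prems(2) is_submoduleD(2)[OF Jm] by (auto simp: vals_def)
      ultimately show ?thesis using nmax by blast
    qed
    thus "vals L' \<subseteq> insert n (vals L)" unfolding vals_def[of L'] by (fastforce simp: L'_def)
    obtain y where y: "y \<in> J" "y \<noteq> 0" "v y = n" using n unfolding vals_def by blast
    hence "y = 0 + y" "y \<in> J \<inter> val_ge n" by (simp_all add: val_ge_def)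
    hence "y \<in> L'" using is_submoduleD(1)[OF Lm] unfolding L'_def by blast
    hence "n \<in> vals L'" using y unfolding vals_def by blast
    thus "insert n (vals L) \<subseteq> vals L'" using vals_mono[OF LL'] by blast
  qed
  hence L'_vals: "vals L' = insert n (vals L)" .
  hence ne': "L \<noteq> L'" using n by blast
  have "vals J - vals L' = (vals J - vals L) - {n}" unfolding L'_vals by blast
  hence "vlen J L' = k" using Suc.hyps(2) card_Diff_singleton[OF n] by (simp add: vlen_def)
  then obtain N where N: "chain_between L' J k N" using Suc.hyps(1)[OF _ L' L'J] by metis
  have "chain_between L J (Suc k) (case_nat L N)"
    unfolding chain_between_def
  proof (intro conjI allI impI)
    fix i assume "i \<le> Suc k"
    thus "is_submodule R (case_nat L N i)" "L \<subseteq> case_nat L N i" "case_nat L N i \<subseteq> J"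
      using N Lm LL' Suc.prems(2) by (auto simp: chain_between_def split: nat.split)
  next
    fix i assume i: "i < Suc k"
    show "case_nat L N i \<subset> case_nat L N (Suc i)"
    proof (cases i)
      case 0
      have "L' \<subseteq> N 0" using N by (simp add: chain_between_def)
      thus ?thesis using 0 LL' ne' by auto
    qed (use N i in \<open>auto simp: chain_between_def\<close>)
  qed
  thus ?case using Suc.hyps(2) by auto
qed

text \<open>
  A strict step in a chain of fractional ideals adds a value by \<open>eq_by_values\<close>, so no chain is longer
  than the number of missing values, and \<open>chain_exists\<close> attains this bound.
\<close>

lemma len_eq_vlen:
  assumes "is_fractional R J" "is_fractional R L" "L \<subseteq> J"
  shows "len R J L = vlen J L"
proof -
  let ?C = "{enat n |n N. chain_between L J n N}"
  have "quotient_length (ring_on R) field_module J L = Sup ?C"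
    by (simp add: quotient_length_def chain_between_def submodule_iff[OF subring])
  also have "\<dots> = enat (vlen J L)"
  proof (rule antisym)
    show "Sup ?C \<le> enat (vlen J L)" by (rule Sup_least) (use chain_length_le[OF assms(1,2)] in auto)
    show "enat (vlen J L) \<le> Sup ?C" by (rule Sup_upper) (use chain_exists[OF assms] in auto)
  qed
  finally show ?thesis by (simp add: len_def)
qed

lemma overring_branch:
  assumes "is_subring S" "R \<subseteq> S" "S \<subseteq> val_ge 0"
  shows "branch v S"
proof
  show "\<exists>a\<in>S. y - a \<in> val_ge 1" if "y \<in> val_ge 0" for y using residual[OF that] assms(2) by blast
  show "\<exists>n. val_ge n \<subseteq> S" using conductor_exists assms(2) by blast
qed (use assms in auto)

text \<open>
  Since \<open>1\<close> is a sum of products \<open>w w'\<close>, some product has value \<open>0\<close> and is therefore a unit of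
  \<open>R\<close>; its factor \<open>w\<close> generates \<open>W\<close>.
\<close>

lemma invertible_imp_principal:
  assumes W: "is_fractional R W" and W': "is_submodule R W'" and eq: "fprod W W' = R"
  shows "\<exists>w\<in>W. w \<noteq> 0 \<and> W = (*) w ` R"
proof -
  have "\<exists>w\<in>W. \<exists>w'\<in>W'. w * w' \<notin> val_ge 1"
  proof (rule ccontr)
    assume "\<not> ?thesis"
    hence "fprod W W' \<subseteq> val_ge 1" by (intro fprod_subset val_ge_add) blast+
    moreover have "1 \<in> fprod W W'" using eq is_subringD(1)[OF subring] by simp
    ultimately show False by (auto simp: val_ge_def)
  qed
  then obtain w w' where w: "w \<in> W" "w' \<in> W'" "w * w' \<notin> val_ge 1" by blast
  have R: "x * w' \<in> R" if "x \<in> W" for x using fprod_memI[OF that w(2)] eq by simp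
  have u: "w * w' \<in> R" "w * w' \<noteq> 0" "v (w * w') = 0"
    using R[OF w(1)] w(3) R_le by (auto simp: val_ge_def)
  have "W \<subseteq> (*) w ` R"
  proof
    fix y assume "y \<in> W"
    hence "y * w' * inverse (w * w') \<in> R"
      using R inverse_unit[OF u] is_subringD(6)[OF subring] by blast
    moreover have "y = w * (y * w' * inverse (w * w'))" using u(2) by (simp add: field_simps)
    ultimately show "y \<in> (*) w ` R" by blast
  qed
  moreover have "(*) w ` R \<subseteq> W"
    using is_submoduleD(3)[OF is_fractionalD(1)[OF W] _ w(1)] by (auto simp: mult.commute)
  ultimately have "W = (*) w ` R" by blast
  moreover have "w \<noteq> 0" using u(2) by auto
  ultimately show ?thesis using w(1) by blast
qed

end

section \<open>The valuation of a discrete valuation ring\<close>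

text \<open>
  An irreducible divisor of \<open>y\<close> generates a maximal ideal, which must be \<open>\<nn>\<close>.
\<close>

lemma unique_maximal_ideal_nonunits:
  fixes W :: "'a::field set"
  assumes "principal_domain (ring_on W)" "local_ring (ring_on W) \<nn>" "y \<in> W" "y \<noteq> 0" "inverse y \<notin> W"
  shows "y \<in> \<nn>"
proof -
  interpret W: principal_domain "ring_on W" by fact
  have W: "is_subring W" by (rule cring_on_is_subring) (rule W.is_cring)
  have "y \<notin> Units (ring_on W)"
  proof
    assume "y \<in> Units (ring_on W)"
    then obtain z where "z \<in> W" "z * y = 1" by (auto simp: Units_def)
    hence "inverse y \<in> W" using inverse_unique[of y z] by (simp add: mult.commute)
    thus False using assms(5) by simp
  qed
  then obtain p where p: "p \<in> W" "ring_irreducible\<^bsub>ring_on W\<^esub> p" "p divides\<^bsub>ring_on W\<^esub> y"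
    using W.exists_irreducible_divisor[of y] assms(3,4) unfolding ring_on_simps by blast
  have "maximalideal (PIdl\<^bsub>ring_on W\<^esub> p) (ring_on W)"
    using W.irreducible_imp_maximalideal p(1,2) by simp
  hence "PIdl\<^bsub>ring_on W\<^esub> p = \<nn>" using assms(2) by (simp add: local_ring_def)
  moreover have "y \<in> PIdl\<^bsub>ring_on W\<^esub> p"
    using p by (auto simp: cgenideal_def factor_def mult.commute)
  ultimately show ?thesis by simp
qed

text \<open>
  A nonunit is divisible by the generator \<open>t\<close> of the maximal ideal, so only an element divisible by
  every power of \<open>t\<close> could fail to be a unit times a power of \<open>t\<close>.  For such an element \<open>y\<close> the
  ideals generated by \<open>y / t\<^sup>k\<close> would increase strictly, although their union is principal.
\<close>

lemma dvr_uniformizer: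
  fixes W :: "'a::field set"
  assumes dvr: "discrete_valuation_ring (ring_on W)" and loc: "local_ring (ring_on W) \<nn>"
  shows "\<exists>t\<in>W. t \<noteq> 0 \<and> inverse t \<notin> W \<and> \<nn> = (*) t ` W \<and>
    (\<forall>y\<in>W - {0}. \<exists>n u. u \<in> W \<and> u \<noteq> 0 \<and> inverse u \<in> W \<and> y = u * t ^ n)"
proof -
  have pd: "principal_domain (ring_on W)" and nf: "\<not> field (ring_on W)"
    using dvr by (auto simp: discrete_valuation_ring_def)
  interpret W: principal_domain "ring_on W" by fact
  have W: "is_subring W" by (rule cring_on_is_subring) (rule W.is_cring)
  have max: "maximalideal \<nn> (ring_on W)" using loc by (simp add: local_ring_def)
  interpret n: maximalideal \<nn> "ring_on W" by fact
  note mem_n = unique_maximal_ideal_nonunits[OF pd loc]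
  obtain t where t: "t \<in> W" "\<nn> = PIdl\<^bsub>ring_on W\<^esub> t"
    using W.exists_gen[OF n.is_ideal] by auto
  have nt: "\<nn> = (*) t ` W" unfolding t(2) by (auto simp: cgenideal_def mult.commute image_iff)
  have t0: "t \<noteq> 0"
  proof
    assume "t = 0"
    hence "\<nn> = {0}" using nt is_subringD(2)[OF W] by auto
    hence "field (ring_on W)" using max W.zeromaximalideal_eq_field by simp
    thus False using nf by simp
  qed
  have tinv: "inverse t \<notin> W"
  proof
    assume "inverse t \<in> W"
    hence "(*) t ` W = W"
      using t(1) t0 is_subringD(6)[OF W] by (auto simp: mem_scale_iff divide_inverse)
    thus False using n.I_notcarr nt by simp
  qed
  have div: "y / t \<in> W" if "y \<in> W" "y \<noteq> 0" "inverse y \<notin> W" for y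
    using mem_n[OF that] mem_scale_iff[OF t0, of y W] nt by simp
  have "\<exists>n u. u \<in> W \<and> u \<noteq> 0 \<and> inverse u \<in> W \<and> y = u * t ^ n" if y: "y \<in> W" "y \<noteq> 0" for y
  proof (rule ccontr)
    assume no: "\<not> ?thesis"
    have in_W: "y / t ^ k \<in> W" for k
    proof (induction k)
      case (Suc k)
      have "y = (y / t ^ k) * t ^ k" "y / t ^ k \<noteq> 0" using t0 y(2) by simp_all
      hence "inverse (y / t ^ k) \<notin> W" using no Suc by blast
      hence "y / t ^ k / t \<in> W" using div Suc \<open>y / t ^ k \<noteq> 0\<close> by blast
      thus ?case by (simp add: mult.commute)
    qed (use y in simp)
    \<comment> \<open>The union of the ideals generated by \<open>y / t ^ k\<close>.\<close>
    define J where "J = {z \<in> W. \<exists>k. z * t ^ k / y \<in> W}"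
    have up: "z * t ^ (k + l) / y \<in> W" if "z * t ^ k / y \<in> W" for z k l
      using is_subringD(6)[OF W that is_subring_pow[OF W t(1), of l]]
      by (simp add: power_add field_simps)
    have "ideal J (ring_on W)"
    proof (rule idealI)
      show "ring (ring_on W)" by (rule W.ring_axioms)
      show "subgroup J (add_monoid (ring_on W))"
      proof (rule group.subgroupI[OF W.a_group])
        show "J \<subseteq> carrier (add_monoid (ring_on W))" by (auto simp: J_def)
        show "J \<noteq> {}" using is_subringD(2)[OF W] by (auto simp: J_def intro!: exI[of _ 0])
        fix a assume a: "a \<in> J"
        then obtain k where k: "a \<in> W" "a * t ^ k / y \<in> W" by (auto simp: J_def)
        have "a + \<ominus>\<^bsub>ring_on W\<^esub> a = 0" using W.r_neg[of a] k(1) by simp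
        hence "inv\<^bsub>add_monoid (ring_on W)\<^esub> a = - a" by (simp add: add_eq_0_iff a_inv_def)
        moreover have "- a * t ^ k / y \<in> W" "- a \<in> W"
          using is_subringD(4)[OF W] k by simp_all
        hence "- a \<in> J" unfolding J_def by blast
        ultimately show "inv\<^bsub>add_monoid (ring_on W)\<^esub> a \<in> J" by simp
        fix b assume b: "b \<in> J"
        then obtain l where l: "b \<in> W" "b * t ^ l / y \<in> W" by (auto simp: J_def)
        have "(a + b) * t ^ (k + l) / y = a * t ^ (k + l) / y + b * t ^ (l + k) / y"
          by (simp add: add.commute distrib_right add_divide_distrib)
        hence "(a + b) * t ^ (k + l) / y \<in> W"
          using is_subringD(3)[OF W] up[OF k(2)] up[OF l(2)] by simp
        moreover have "a + b \<in> W" using is_subringD(3)[OF W] k l by blast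
        ultimately show "a \<otimes>\<^bsub>add_monoid (ring_on W)\<^esub> b \<in> J" by (auto simp: J_def)
      qed
      fix a x assume "a \<in> J" "x \<in> carrier (ring_on W)"
      then obtain k where k: "a \<in> W" "x \<in> W" "a * t ^ k / y \<in> W" by (auto simp: J_def)
      have "x * (a * t ^ k / y) \<in> W" "x * a \<in> W" using is_subringD(6)[OF W] k by blast+
      hence "x * a \<in> J" by (auto simp: J_def mult.assoc intro!: exI[of _ k])
      thus "x \<otimes>\<^bsub>ring_on W\<^esub> a \<in> J" "a \<otimes>\<^bsub>ring_on W\<^esub> x \<in> J" by (simp_all add: mult.commute)
    qed
    then obtain g where g: "g \<in> W" "J = PIdl\<^bsub>ring_on W\<^esub> g" using W.exists_gen by auto
    have "g \<in> J" using g W.cgenideal_self[of g] by simp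
    then obtain k where k: "g * t ^ k / y \<in> W" by (auto simp: J_def)
    have "y / t ^ Suc k \<in> J"
      using in_W[of "Suc k"] t0 y is_subringD(1)[OF W] by (auto simp: J_def intro!: exI[of _ "Suc k"])
    then obtain a where a: "a \<in> W" "y / t ^ Suc k = a * g"
      unfolding g(2) by (auto simp: cgenideal_def)
    have "y = a * g * t ^ Suc k" using a(2) t0 by (simp add: divide_eq_eq)
    hence "inverse t = a * (g * t ^ k / y)" using y t0 by (simp add: field_simps)
    thus False using tinv is_subringD(6)[OF W a(1) k] by simp
  qed
  thus ?thesis using t(1) t0 tinv nt by blast
qed

lemma dvr_valuation:
  fixes W :: "'a::field set"
  assumes dvr: "discrete_valuation_ring (ring_on W)" and loc: "local_ring (ring_on W) \<nn>"
    and quot: "is_quotient_field_of W"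
  obtains v where "discrete_valuation v" "W = discrete_valuation.val_ge v 0"
    "\<nn> = discrete_valuation.val_ge v 1"
proof -
  obtain t where t: "t \<in> W" "t \<noteq> 0" "inverse t \<notin> W" "\<nn> = (*) t ` W"
    and fac: "\<forall>y\<in>W - {0}. \<exists>n u. u \<in> W \<and> u \<noteq> 0 \<and> inverse u \<in> W \<and> y = u * t ^ n"
    using dvr_uniformizer[OF dvr loc] by blast
  have "cring (ring_on W)" using loc by (simp add: local_ring_def)
  hence W: "is_subring W" by (rule cring_on_is_subring)
  define U where "U = {u \<in> W. u \<noteq> 0 \<and> inverse u \<in> W}"
  have Uinv: "inverse u \<in> U" if "u \<in> U" for u using that by (auto simp: U_def)
  have Umult: "u * w \<in> U" if "u \<in> U" "w \<in> U" for u w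
    using that is_subringD(6)[OF W] by (auto simp: U_def)
  have ex: "\<exists>n u. u \<in> U \<and> y = u * t powi n" if "y \<noteq> 0" for y
  proof -
    obtain a b where ab: "a \<in> W" "b \<in> W" "b \<noteq> 0" "y = a / b"
      using quot unfolding is_quotient_field_of_def by blast
    have "a \<noteq> 0" using ab(4) that by auto
    then obtain m u where u: "u \<in> U" "a = u * t ^ m" using fac ab that unfolding U_def by blast
    obtain n w where w: "w \<in> U" "b = w * t ^ n" using fac ab unfolding U_def by blast
    have "y = (u * inverse w) * t powi (int m - int n)"
      using t(2) by (simp add: ab(4) u w power_int_diff divide_simps)
    thus ?thesis using Umult Uinv u w by blast
  qed
  \<comment> \<open>A positive power of \<open>t\<close> is not a unit; hence the exponent of \<open>t\<close> is unique.\<close>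
  have U_not: "n \<le> 0" if "u \<in> U" "w \<in> U" "u * t powi n = w" for u w n
  proof (rule ccontr)
    assume "\<not> n \<le> 0"
    then obtain k where k: "n = int (Suc k)" by (metis not_le zero_less_imp_eq_int gr0_conv_Suc)
    have "inverse t = u * inverse w * t ^ k"
      using that t(2) by (auto simp: k U_def power_int_add field_simps)
    moreover have "u * inverse w * t ^ k \<in> W"
      using that is_subringD(6)[OF W] is_subring_pow[OF W t(1)] by (auto simp: U_def)
    ultimately show False using t(3) by simp
  qed
  have unique: "m = n" if "u \<in> U" "w \<in> U" "u * t powi m = w * t powi n" for u w m n
  proof -
    have "u * t powi (m - n) = w" "w * t powi (n - m) = u"
      using that(3) t(2) by (simp_all add: power_int_diff field_simps)
    thus ?thesis using U_not[of u w "m - n"] U_not[of w u "n - m"] that by simp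
  qed
  define v where "v y = (THE n. \<exists>u\<in>U. y = u * t powi n)" for y
  have v_eq: "v (u * t powi n) = n" if "u \<in> U" for u n
    unfolding v_def using that unique by (intro the_equality) blast+
  have v_ex: "\<exists>u\<in>U. y = u * t powi v y" if "y \<noteq> 0" for y
    using ex[OF that] v_eq by metis
  have v_mult: "v (x * y) = v x + v y" if xy: "x \<noteq> 0" "y \<noteq> 0" for x y
  proof -
    obtain u where u: "u \<in> U" "x = u * t powi v x" using v_ex xy by blast
    obtain w where w: "w \<in> U" "y = w * t powi v y" using v_ex xy by blast
    have "x * y = (u * t powi v x) * (w * t powi v y)" using u(2) w(2) by simp
    also have "\<dots> = (u * w) * t powi (v x + v y)" using t(2) by (simp add: power_int_add)
    finally show ?thesis using v_eq[OF Umult[OF u(1) w(1)]] by simp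
  qed
  have W_iff: "y \<in> W \<longleftrightarrow> 0 \<le> v y" if y: "y \<noteq> 0" for y
  proof
    assume "y \<in> W"
    then obtain n u where u: "u \<in> U" "y = u * t ^ n" using fac y unfolding U_def by blast
    thus "0 \<le> v y" using v_eq[of u "int n"] by simp
  next
    assume v: "0 \<le> v y"
    obtain u where u: "u \<in> U" "y = u * t powi v y" using v_ex y by blast
    have eq: "y = u * t ^ nat (v y)" using v u(2) by (metis power_int_def)
    have "u \<in> W" using u(1) by (simp add: U_def)
    hence "u * t ^ nat (v y) \<in> W" using is_subringD(6)[OF W] is_subring_pow[OF W t(1)] by blast
    thus "y \<in> W" by (subst eq)
  qed
  have v_t: "v t = 1"
    using v_eq[of 1 1] is_subringD(1)[OF W] by (simp add: U_def)
  have "1 \<in> U" using is_subringD(1)[OF W] by (simp add: U_def)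
  hence v_pow: "v (t powi n) = n" for n using v_eq[of 1 n] by simp
  have v_add: "min (v x) (v y) \<le> v (x + y)" if xy: "x \<noteq> 0" "y \<noteq> 0" "x + y \<noteq> 0" for x y
  proof -
    \<comment> \<open>Divide by \<open>t\<close> to the smaller value: both summands then lie in the ring \<open>W\<close>.\<close>
    define k where "k = min (v x) (v y)"
    have *: "v (z * t powi (- k)) = v z - k" if "z \<noteq> 0" for z
      using v_mult[OF that, of "t powi (- k)"] v_pow[of "- k"] t(2) by simp
    have "x * t powi (- k) \<in> W" "y * t powi (- k) \<in> W"
      using xy t(2) *[of x] *[of y] W_iff[of "x * t powi (- k)"] W_iff[of "y * t powi (- k)"]
      by (auto simp: k_def)
    hence "(x + y) * t powi (- k) \<in> W" using is_subringD(3)[OF W] by (simp add: distrib_right)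
    hence "0 \<le> v (x + y) - k"
      using W_iff[of "(x + y) * t powi (- k)"] *[of "x + y"] xy(3) t(2) by simp
    thus ?thesis by (simp add: k_def)
  qed
  interpret discrete_valuation v
  proof
    show "v (x * y) = v x + v y" if "x \<noteq> 0" "y \<noteq> 0" for x y using v_mult that .
    show "min (v x) (v y) \<le> v (x + y)" if "x \<noteq> 0" "y \<noteq> 0" "x + y \<noteq> 0" for x y
      using v_add that .
    show "\<exists>t. t \<noteq> 0 \<and> v t = 1" using v_t t(2) by blast
  qed
  have "y \<in> W \<longleftrightarrow> y \<in> val_ge 0" for y
    using W_iff[of y] is_subringD(2)[OF W] by (cases "y = 0") (simp_all add: val_ge_def)
  hence W_eq: "W = val_ge 0" by blast
  have "\<nn> = val_ge 1" using t(4) val_ge_scale[OF t(2), of 0] v_t by (simp add: W_eq)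
  thus ?thesis using that[OF discrete_valuation_axioms W_eq] by simp
qed

section \<open>Canonical ideals and duality\<close>

locale canonical_branch = branch v R for v :: "'a::field \<Rightarrow> int" and R :: "'a set" +
  fixes \<omega> :: "'a set"
  assumes omega_fractional: "is_fractional R \<omega>"
    and dual_dual: "is_fractional R J \<Longrightarrow> colon \<omega> (colon \<omega> J) = J"
begin

lemmas omega_submodule = is_fractionalD(1)[OF omega_fractional]

lemma omega_colon_R: "colon \<omega> R = \<omega>"
  by (rule colon_ring_self[OF subring omega_submodule])

lemma omega_colon_self: "colon \<omega> \<omega> = R"
  using dual_dual[OF R_fractional] by (simp add: omega_colon_R)

lemma dual_fractional: "is_fractional R J \<Longrightarrow> is_fractional R (colon \<omega> J)"
  by (rule colon_fractional[OF omega_fractional])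

lemma dual_inject:
  assumes "is_fractional R J" "is_fractional R L"
  shows "colon \<omega> J = colon \<omega> L \<longleftrightarrow> J = L"
  using dual_dual[OF assms(1)] dual_dual[OF assms(2)] by metis

text \<open>
  As \<open>R = \<omega> : \<omega>\<close>, colons into \<open>R\<close> are colons into \<open>\<omega>\<close>, to which duality applies.
\<close>

lemma R_colon_eq: "colon R J = colon \<omega> (fprod \<omega> J)"
  using colon_fprod[OF omega_submodule, of \<omega> J] by (simp add: omega_colon_self)

text \<open>
  A strict chain from \<open>L\<close> to \<open>J\<close> is turned by \<open>\<omega> : _\<close> into a strict chain in the reverse
  direction, because \<open>\<omega> : _\<close> is injective on fractional ideals.
\<close>

lemma vlen_dual_le:
  assumes J: "is_fractional R J" and L: "is_fractional R L" and le: "L \<subseteq> J"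
  shows "vlen J L \<le> vlen (colon \<omega> L) (colon \<omega> J)"
proof -
  obtain N where N: "chain_between L J (vlen J L) N" using chain_exists[OF J L le] by blast
  define n where "n = vlen J L"
  have between: "is_submodule R (N i)" "L \<subseteq> N i" "N i \<subseteq> J" if "i \<le> n" for i
    using N that unfolding chain_between_def n_def by blast+
  have step: "N i \<subset> N (Suc i)" if "i < n" for i
    using N that unfolding chain_between_def n_def by blast
  have fr: "is_fractional R (N i)" if "i \<le> n" for i
    using between_fractional[OF between[OF that] L J] .
  have "chain_between (colon \<omega> J) (colon \<omega> L) n (\<lambda>i. colon \<omega> (N (n - i)))"
    unfolding chain_between_def
  proof (intro conjI allI impI)
    fix i assume "i \<le> n"
    show "is_submodule R (colon \<omega> (N (n - i)))" by (rule colon_submodule[OF omega_submodule])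
    show "colon \<omega> J \<subseteq> colon \<omega> (N (n - i))" using between(3)[of "n - i"] by (intro colon_mono) simp_all
    show "colon \<omega> (N (n - i)) \<subseteq> colon \<omega> L" using between(2)[of "n - i"] by (intro colon_mono) simp_all
  next
    fix i assume i: "i < n"
    hence "N (n - Suc i) \<subset> N (Suc (n - Suc i))" by (intro step) simp
    hence *: "N (n - Suc i) \<subset> N (n - i)" using i by (simp add: Suc_diff_Suc)
    hence "colon \<omega> (N (n - i)) \<subseteq> colon \<omega> (N (n - Suc i))" by (intro colon_mono) auto
    moreover have "colon \<omega> (N (n - i)) \<noteq> colon \<omega> (N (n - Suc i))"
      using dual_inject[OF fr[of "n - i"] fr[of "n - Suc i"]] * by simp
    ultimately show "colon \<omega> (N (n - i)) \<subset> colon \<omega> (N (n - Suc i))" by blast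
  qed
  thus ?thesis
    using chain_length_le[OF dual_fractional[OF L] dual_fractional[OF J]] by (simp add: n_def)
qed

lemma vlen_dual:
  assumes J: "is_fractional R J" and L: "is_fractional R L" and le: "L \<subseteq> J"
  shows "vlen (colon \<omega> L) (colon \<omega> J) = vlen J L"
proof -
  have "colon \<omega> J \<subseteq> colon \<omega> L" using le by (rule colon_mono[OF subset_refl])
  hence "vlen (colon \<omega> L) (colon \<omega> J) \<le> vlen J L"
    using vlen_dual_le[OF dual_fractional[OF L] dual_fractional[OF J]]
    by (simp add: dual_dual[OF J] dual_dual[OF L])
  thus ?thesis using vlen_dual_le[OF assms] by simp
qed

text \<open>
  For a module \<open>J\<close> over \<open>S\<close> one has \<open>SJ = J\<close> and thus \<open>(\<omega> : S) : J = \<omega> : J\<close>, so duality over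
  \<open>S\<close> with respect to \<open>\<omega> : S\<close> is duality over \<open>R\<close> with respect to \<open>\<omega>\<close>.
\<close>

lemma overring_canonical:
  assumes S: "is_subring S" "R \<subseteq> S" "S \<subseteq> val_ge 0"
  shows "canonical_branch v S (colon \<omega> S)"
proof -
  interpret S: branch v S by (rule overring_branch[OF S])
  have dual: "is_fractional S (colon \<omega> J)" if "is_fractional S J" for J
    using dual_fractional[OF is_fractional_antimono[OF S(2) that]]
      colon_submodule_right[OF omega_submodule is_fractionalD(1)[OF that]]
    by (simp add: is_fractional_def)
  have eq: "colon (colon \<omega> S) J = colon \<omega> J" if "is_fractional S J" for J
    using colon_fprod[OF omega_submodule, of S J]
      fprod_ring_left[OF S(1) is_fractionalD(1)[OF that]] by simp
  show ?thesis
  proof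
    show "is_fractional S (colon \<omega> S)" by (rule dual[OF S.R_fractional])
    show "colon (colon \<omega> S) (colon (colon \<omega> S) J) = J" if "is_fractional S J" for J
      using eq[OF that] eq[OF dual[OF that]] dual_dual[OF is_fractional_antimono[OF S(2) that]]
      by simp
  qed
qed

lemma scale_canonical:
  assumes "z \<noteq> 0"
  shows "canonical_branch v R ((*) z ` \<omega>)"
proof
  show "is_fractional R ((*) z ` \<omega>)" by (rule scale_fractional[OF omega_fractional assms])
  show "colon ((*) z ` \<omega>) (colon ((*) z ` \<omega>) J) = J" if "is_fractional R J" for J
    using assms dual_dual[OF that]
    by (simp add: colon_scale_left colon_scale_right scale_scale)
qed

end

context branch
begin

lemma canonical_iff: "canonical_ideal R W \<longleftrightarrow> canonical_branch v R W"
  by (simp add: canonical_ideal_def fractional_iff canonical_branch_def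
      canonical_branch_axioms_def branch_axioms)

lemma gorenstein_iff: "gorenstein R \<longleftrightarrow> canonical_branch v R R"
  by (simp add: gorenstein_def canonical_iff)

end

text \<open>
  This is uniqueness of canonical ideals in the case needed.  With \<open>W = R : \<omega>\<close> one has
  \<open>R : W\<omega> = (R : W) : \<omega> = \<omega> : \<omega> = R\<close>, hence \<open>W\<omega> = R\<close> by duality with respect to \<open>R\<close>, and an
  invertible ideal is principal.
\<close>

lemma (in canonical_branch) gorenstein_imp_principal:
  assumes "gorenstein R"
  shows "\<exists>z. z \<noteq> 0 \<and> \<omega> = (*) z ` R"
proof -
  interpret G: canonical_branch v R R using assms gorenstein_iff by simp
  define W where "W = colon R \<omega>"
  have W: "is_fractional R W" unfolding W_def by (rule G.dual_fractional[OF omega_fractional])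
  have "colon R (fprod W \<omega>) = colon (colon R W) \<omega>" by (rule colon_fprod[OF G.omega_submodule])
  also have "\<dots> = R" unfolding W_def G.dual_dual[OF omega_fractional] by (rule omega_colon_self)
  finally have "fprod W \<omega> = R"
    using G.dual_dual[OF fprod_fractional[OF W omega_fractional]] G.omega_colon_self by simp
  hence "fprod \<omega> W = R" by (simp add: fprod_commute)
  thus ?thesis
    using invertible_imp_principal[OF omega_fractional is_fractionalD(1)[OF W]] by blast
qed

section \<open>Almost Gorenstein branches\<close>

text \<open>
  The intersection \<open>R \<inter> val_ge 1\<close> is the maximal ideal of \<open>R\<close> (\<open>maximal_ideal_eq\<close>).
\<close>

locale almost_gorenstein_branch = canonical_branch v R \<omega>
  for v :: "'a::field \<Rightarrow> int" and R \<omega> :: "'a set" +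
  assumes R_le_omega: "R \<subseteq> \<omega>" and omega_le: "\<omega> \<subseteq> val_ge 0"
    and almost_gorenstein: "fprod (R \<inter> val_ge 1) \<omega> = R \<inter> val_ge 1"
begin

lemma maximal_ideal_fractional: "is_fractional R (R \<inter> val_ge 1)"
proof -
  obtain n where n: "val_ge n \<subseteq> R" using conductor_exists by blast
  obtain x where x: "x \<noteq> 0" "v x = max n 1" using ex_value by blast
  have "x \<in> val_ge n" "x \<in> val_ge 1" using x by (simp_all add: val_ge_def)
  hence "R \<inter> val_ge 1 \<noteq> {0}" using n x(1) by blast
  moreover have "is_submodule R (R \<inter> val_ge 1)"
    using is_submodule_self[OF subring] is_fractionalD(1)[OF val_ge_fractional[of 1]]
    by (simp add: is_submodule_def)
  ultimately show ?thesis unfolding is_fractional_def by blast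
qed

lemma vlen_residue_field: "vlen R (R \<inter> val_ge 1) = 1"
proof -
  have "vals R - vals (R \<inter> val_ge 1) = {0}"
  proof
    show "vals R - vals (R \<inter> val_ge 1) \<subseteq> {0}"
    proof
      fix k assume k: "k \<in> vals R - vals (R \<inter> val_ge 1)"
      then obtain x where x: "x \<in> R" "x \<noteq> 0" "v x = k" unfolding vals_def by blast
      hence "0 \<le> v x" using R_le by (auto simp: val_ge_def)
      moreover have "x \<notin> val_ge 1"
      proof
        assume "x \<in> val_ge 1"
        hence "x \<in> R \<inter> val_ge 1 - {0}" using x by simp
        hence "k \<in> vals (R \<inter> val_ge 1)" unfolding vals_def x(3)[symmetric] by (rule imageI)
        thus False using k by simp
      qed
      ultimately show "k \<in> {0}" using x by (simp add: val_ge_def)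
    qed
    have "v 1 \<in> vals R" unfolding vals_def by (rule imageI) (simp add: is_subringD(1)[OF subring])
    hence "0 \<in> vals R" by simp
    moreover have "0 \<notin> vals (R \<inter> val_ge 1)" by (auto simp: vals_def val_ge_def)
    ultimately show "{0} \<subseteq> vals R - vals (R \<inter> val_ge 1)" by blast
  qed
  thus ?thesis by (simp add: vlen_def)
qed

text \<open>
  By \<open>\<mm>\<omega> = \<mm>\<close> the colon \<open>R : \<mm>\<close> equals \<open>\<omega> : \<mm>\<close>, and the length of \<open>(\<omega> : \<mm>) / \<omega>\<close> is dual
  to that of \<open>R / \<mm>\<close>.
\<close>

lemma vlen_type: "vlen (colon R (R \<inter> val_ge 1)) R = 1 + vlen \<omega> R"
proof -
  let ?m = "R \<inter> val_ge 1"
  have eq: "colon R ?m = colon \<omega> ?m"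
    using R_colon_eq[of ?m] almost_gorenstein by (simp add: fprod_commute)
  have "\<omega> \<subseteq> colon \<omega> ?m" using colon_mono[of \<omega> \<omega> ?m R] by (simp add: omega_colon_R)
  hence "vlen (colon \<omega> ?m) R = vlen (colon \<omega> ?m) \<omega> + vlen \<omega> R"
    using R_le_omega
    by (intro vlen_add[OF dual_fractional[OF maximal_ideal_fractional] R_fractional])
  moreover have "vlen (colon \<omega> ?m) \<omega> = 1"
    using vlen_dual[OF R_fractional maximal_ideal_fractional] vlen_residue_field
    by (simp add: omega_colon_R)
  ultimately show ?thesis by (simp add: eq)
qed

text \<open>
  For \<open>z\<close> in \<open>R : S\<close> the set \<open>zS\<close> lies in the maximal ideal: otherwise \<open>z\<close> would be a unit of \<open>R\<close>
  and \<open>S\<close> would be contained in \<open>R\<close>.  Multiplication by \<open>\<omega>\<close> keeps the maximal ideal inside itself.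
\<close>

lemma overring_conductor_stable:
  assumes S: "is_subring S" "S \<subseteq> val_ge 0" "\<not> S \<subseteq> R"
  shows "fprod \<omega> (colon R S) = colon R S"
proof
  have one: "1 \<in> \<omega>" using R_le_omega is_subringD(1)[OF subring] by blast
  show "colon R S \<subseteq> fprod \<omega> (colon R S)"
    using fprod_memI[OF one, of _ "colon R S"] by auto
  have m: "z * s \<in> R \<inter> val_ge 1" if z: "z \<in> colon R S" and s: "s \<in> S" for z s
  proof (rule ccontr)
    assume *: "z * s \<notin> R \<inter> val_ge 1"
    have zs: "z * s' \<in> R" if "s' \<in> S" for s' using z that by (simp add: colon_def)
    have zR: "z \<in> R" using zs[OF is_subringD(1)[OF S(1)]] by simp
    have nz: "z \<noteq> 0" "s \<noteq> 0" "v (z * s) < 1" using * zs[OF s] by (auto simp: val_ge_def)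
    moreover have "0 \<le> v z" "0 \<le> v s" using zR R_le s S(2) nz by (auto simp: val_ge_def)
    ultimately have "v z = 0" using v_mult[of z s] by simp
    hence "inverse z \<in> R" using inverse_unit[OF zR nz(1)] by simp
    hence "inverse z * (z * s') \<in> R" if "s' \<in> S" for s' using zs[OF that] is_subringD(6)[OF subring] by blast
    moreover have "inverse z * (z * s') = s'" for s' using nz(1) by simp
    ultimately have "S \<subseteq> R" by (metis subsetI)
    thus False using S(3) by simp
  qed
  show "fprod \<omega> (colon R S) \<subseteq> colon R S"
  proof (rule fprod_subset)
    fix w z assume w: "w \<in> \<omega>" and z: "z \<in> colon R S"
    have "w * z * s \<in> R" if "s \<in> S" for s
    proof -
      have "z * s * w \<in> fprod (R \<inter> val_ge 1) \<omega>" by (rule fprod_memI[OF m[OF z that] w])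
      thus ?thesis using almost_gorenstein by (simp add: ac_simps)
    qed
    thus "w * z \<in> colon R S" by (simp add: colon_def)
  qed (rule is_submoduleD(2)[OF colon_submodule[OF is_submodule_self[OF subring]]])
qed

text \<open>
  With \<open>J = R : S\<close> the previous lemma gives \<open>R : J = \<omega> : \<omega>J = \<omega> : J\<close>, and the length of
  \<open>(\<omega> : J) / \<omega>\<close> is dual to that of \<open>R / J\<close>.
\<close>

lemma vlen_bidual:
  assumes S: "is_subring S" "R \<subseteq> S" "S \<subseteq> val_ge 0" "S \<noteq> R"
  shows "vlen (bidual R S) R = vlen \<omega> R + vlen R (colon R S)"
proof -
  interpret S: branch v S by (rule overring_branch[OF S(1-3)])
  have SR: "is_fractional R S" by (rule is_fractional_antimono[OF S(2) S.R_fractional])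
  define J where "J = colon R S"
  have J: "is_fractional R J" unfolding J_def by (rule colon_fractional[OF R_fractional SR])
  have JR: "J \<subseteq> R"
  proof
    fix y assume "y \<in> J"
    hence "y * 1 \<in> R" using is_subringD(1)[OF S(1)] unfolding J_def colon_def by blast
    thus "y \<in> R" by simp
  qed
  have "fprod \<omega> J = J" unfolding J_def using S by (intro overring_conductor_stable) auto
  hence eq: "bidual R S = colon \<omega> J" using R_colon_eq[of J] by (simp add: bidual_def J_def)
  have "\<omega> \<subseteq> colon \<omega> J" using colon_mono[OF subset_refl JR, of \<omega>] by (simp add: omega_colon_R)
  hence "vlen (colon \<omega> J) R = vlen (colon \<omega> J) \<omega> + vlen \<omega> R"
    using R_le_omega by (intro vlen_add[OF dual_fractional[OF J] R_fractional])
  moreover have "vlen (colon \<omega> J) \<omega> = vlen R J"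
    using vlen_dual[OF R_fractional J JR] by (simp add: omega_colon_R)
  ultimately show ?thesis by (simp add: eq J_def)
qed

end

section \<open>Blowing up\<close>

locale branch_ideal = branch v R for v :: "'a::field \<Rightarrow> int" and R :: "'a set" +
  fixes I :: "'a set"
  assumes I_fractional: "is_fractional R I" and I_le_R: "I \<subseteq> R" and I_le: "I \<subseteq> val_ge 1"
begin

lemmas I_submodule = is_fractionalD(1)[OF I_fractional]
lemmas pow_fractional = fpow_fractional[OF I_fractional]
lemmas pow_submodule = fpow_submodule[OF subring I_submodule]

definition min_valued :: "'a \<Rightarrow> bool" where
  "min_valued x \<longleftrightarrow> x \<in> I \<and> x \<noteq> 0 \<and> (\<forall>y\<in>I. y \<noteq> 0 \<longrightarrow> v x \<le> v y)"

lemma min_valuedD: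
  assumes "min_valued x"
  shows "x \<in> I" "x \<noteq> 0" "y \<in> I \<Longrightarrow> y \<noteq> 0 \<Longrightarrow> v x \<le> v y" "1 \<le> v x"
proof -
  show x: "x \<in> I" "x \<noteq> 0" and "y \<in> I \<Longrightarrow> y \<noteq> 0 \<Longrightarrow> v x \<le> v y"
    using assms unfolding min_valued_def by blast+
  have "x \<in> val_ge 1" using I_le x(1) by blast
  thus "1 \<le> v x" using x(2) by (simp add: val_ge_def)
qed

lemma min_valued_exists: "\<exists>x. min_valued x"
proof -
  obtain x where "x \<in> I" "x \<noteq> 0" "\<And>y. y \<in> I \<Longrightarrow> y \<noteq> 0 \<Longrightarrow> v x \<le> v y"
    using ex_min_value[OF I_fractional] by blast
  thus ?thesis unfolding min_valued_def by blast
qed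

lemma pow_Suc_scale_subset:
  assumes "x \<in> I"
  shows "(*) x ` fpow R I n \<subseteq> fpow R I (Suc n)"
proof
  fix y assume "y \<in> (*) x ` fpow R I n"
  then obtain z where "z \<in> fpow R I n" "y = x * z" by blast
  thus "y \<in> fpow R I (Suc n)" using fprod_memI[OF assms] by simp
qed

lemma pow_le_R: "fpow R I n \<subseteq> R"
proof (induction n)
  case (Suc n)
  have "fprod I (fpow R I n) \<subseteq> fprod R R" by (rule fprod_mono[OF I_le_R Suc])
  thus ?case by (simp add: fprod_square[OF subring])
qed simp

lemma pow_le_val:
  assumes "min_valued x"
  shows "fpow R I n \<subseteq> val_ge (int n * v x)"
proof (induction n)
  case (Suc n)
  have I: "I \<subseteq> val_ge (v x)" using min_valuedD(3)[OF assms] by (auto simp: val_ge_def)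
  have eq: "int (Suc n) * v x = v x + int n * v x" by (simp add: algebra_simps)
  show ?case unfolding eq fpow.simps
  proof (rule fprod_subset)
    fix i j assume "i \<in> I" "j \<in> fpow R I n"
    with I Suc show "i * j \<in> val_ge (v x + int n * v x)" by (intro val_ge_mult) auto
  qed (rule val_ge_add)
qed (use R_le in simp)

lemma power_mem_pow: "x \<in> I \<Longrightarrow> x ^ n \<in> fpow R I n"
  by (induction n) (simp_all add: is_subringD(1)[OF subring] fprod_memI)

text \<open>
  The modules \<open>x\<^sup>-\<^sup>n I\<^sup>n\<close> increase because \<open>x\<close> lies in \<open>I\<close>, and they stay in the normalisation
  because \<open>x\<close> has least value.  The length of the normalisation modulo these modules cannot drop
  forever, so they become equal, which means \<open>I\<^sup>n\<^sup>+\<^sup>1 = x I\<^sup>n\<close>.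
\<close>

lemma min_valued_imp_reduction:
  assumes x: "min_valued x"
  shows "minimal_reduction R I x"
proof -
  note x0 = min_valuedD(2)[OF x] and xI = min_valuedD(1)[OF x]
  define B where "B n = (*) (inverse (x ^ n)) ` fpow R I n" for n
  have inv0: "inverse (x ^ n) \<noteq> 0" for n using x0 by simp
  have fr: "is_fractional R (B n)" for n
    unfolding B_def by (rule scale_fractional[OF pow_fractional inv0])
  have bounded: "B n \<subseteq> val_ge 0" for n
  proof -
    have "B n \<subseteq> (*) (inverse (x ^ n)) ` val_ge (int n * v x)"
      unfolding B_def by (rule image_mono[OF pow_le_val[OF x]])
    also have "\<dots> = val_ge 0" using x0 by (simp add: val_ge_scale[OF inv0] v_inverse v_power)
    finally show ?thesis .
  qed
  have Suc_eq: "B n = (*) (inverse (x ^ Suc n)) ` (*) x ` fpow R I n" for n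
  proof -
    have "inverse (x ^ Suc n) * x = inverse (x ^ n)" using x0 by simp
    thus ?thesis by (simp only: B_def scale_scale)
  qed
  have step: "B n \<subseteq> B (Suc n)" for n
    unfolding Suc_eq[of n] B_def[of "Suc n"] by (rule image_mono[OF pow_Suc_scale_subset[OF xI]])
  have mono: "B m \<subseteq> B n" if "m \<le> n" for m n using lift_Suc_mono_le[of B, OF step that] .
  obtain N where N: "\<And>n. vlen (val_ge 0) (B N) \<le> vlen (val_ge 0) (B n)"
    using ex_has_least_nat[of "\<lambda>_. True" 0 "\<lambda>n. vlen (val_ge 0) (B n)"] by blast
  have stable: "B n = B N" if "N \<le> n" for n
  proof -
    have "vlen (val_ge 0) (B N) = vlen (val_ge 0) (B n) + vlen (B n) (B N)"
      by (rule vlen_add[OF val_ge_fractional fr mono[OF that] bounded])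
    hence "vlen (B n) (B N) = 0" using N[of n] by simp
    thus ?thesis using vlen_eq_0_iff[OF fr fr mono[OF that]] by simp
  qed
  have "fpow R I (Suc n) = (*) x ` fpow R I n" if "N \<le> n" for n
  proof -
    have "B (Suc n) = B n" using stable[of n] stable[of "Suc n"] that by simp
    thus ?thesis unfolding Suc_eq[of n] B_def[of "Suc n"] scale_inject(1)[OF inv0] .
  qed
  thus ?thesis using xI unfolding minimal_reduction_def eventually_sequentially by blast
qed

text \<open>
  If \<open>I\<^sup>n\<^sup>+\<^sup>1 = x I\<^sup>n\<close> and \<open>z\<close> has least value in \<open>I\<^sup>n\<close>, then an element \<open>y\<close> of \<open>I\<close> of value
  less than \<open>v x\<close> would give an element \<open>y z / x\<close> of \<open>I\<^sup>n\<close> of value less than \<open>v z\<close>.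
\<close>

lemma reduction_imp_min_valued:
  assumes "minimal_reduction R I x"
  shows "min_valued x"
proof -
  have xI: "x \<in> I" using assms by (simp add: minimal_reduction_def)
  obtain n where n: "fpow R I (Suc n) = (*) x ` fpow R I n"
    using assms unfolding minimal_reduction_def eventually_sequentially by blast
  have x0: "x \<noteq> 0"
  proof
    assume "x = 0"
    hence "fpow R I (Suc n) \<subseteq> {0}" unfolding n by auto
    thus False using is_fractionalD(2)[OF pow_fractional[of "Suc n"]] by blast
  qed
  have "v x \<le> v y" if y: "y \<in> I" "y \<noteq> 0" for y
  proof -
    obtain z where z: "z \<in> fpow R I n" "z \<noteq> 0" "\<And>w. w \<in> fpow R I n \<Longrightarrow> w \<noteq> 0 \<Longrightarrow> v z \<le> v w"
      using ex_min_value[OF pow_fractional] by blast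
    have "y * z \<in> fpow R I (Suc n)" using fprod_memI[OF y(1) z(1)] by simp
    then obtain w where w: "w \<in> fpow R I n" "y * z = x * w" unfolding n by blast
    have w0: "w \<noteq> 0" using w(2) y z by auto
    hence "v y + v z = v x + v w" using w(2) v_mult[OF y(2) z(2)] v_mult[OF x0 w0] by simp
    thus ?thesis using z(3)[OF w(1) w0] by simp
  qed
  thus ?thesis using xI x0 by (simp add: min_valued_def)
qed

text \<open>
  Two minimal reductions have the same value, so \<open>x I\<^sup>n\<close> and \<open>y I\<^sup>n\<close> have the same values, and
  \<open>eq_by_values\<close> applies.  Hence the reduction exponent does not depend on the reduction.
\<close>

lemma reduction_step_independent:
  assumes x: "min_valued x" and y: "min_valued y" and eq: "fpow R I (Suc n) = (*) x ` fpow R I n"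
  shows "fpow R I (Suc n) = (*) y ` fpow R I n"
proof (rule eq_by_values[OF pow_fractional])
  note x' = min_valuedD[OF x] and y' = min_valuedD[OF y]
  have "v x = v y" using x'(3)[OF y'(1,2)] y'(3)[OF x'(1,2)] by simp
  thus "vals (fpow R I (Suc n)) \<subseteq> vals ((*) y ` fpow R I n)"
    unfolding eq by (simp add: vals_scale x'(2) y'(2))
  show "(*) y ` fpow R I n \<subseteq> fpow R I (Suc n)" by (rule pow_Suc_scale_subset[OF y'(1)])
  show "is_fractional R ((*) y ` fpow R I n)" by (rule scale_fractional[OF pow_fractional y'(2)])
qed

lemma reduction_exponent_property:
  assumes x: "min_valued x" and n: "reduction_exponent R I \<le> n"
  shows "fpow R I (Suc n) = (*) x ` fpow R I n"
proof -
  define P where "P y N \<longleftrightarrow> (\<forall>n\<ge>N. fpow R I (Suc n) = (*) y ` fpow R I n)" for y N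
  have P_eq: "P y = P x" if y: "min_valued y" for y
  proof (rule ext)
    fix N
    have "fpow R I (Suc n) = (*) y ` fpow R I n \<longleftrightarrow> fpow R I (Suc n) = (*) x ` fpow R I n" for n
      using reduction_step_independent[OF y x, of n] reduction_step_independent[OF x y, of n] by (rule iffI)
    thus "P y N = P x N" by (simp only: P_def)
  qed
  have "reduction_exponent R I = (LEAST N. P x N)"
    unfolding reduction_exponent_def P_def[symmetric]
  proof (rule the_equality)
    show "\<exists>y. minimal_reduction R I y \<and> (LEAST N. P x N) = (LEAST N. P y N)"
      using min_valued_imp_reduction[OF x] by blast
  next
    fix k assume "\<exists>y. minimal_reduction R I y \<and> k = (LEAST N. P y N)"
    then obtain y where y: "minimal_reduction R I y" "k = (LEAST N. P y N)" by blast
    show "k = (LEAST N. P x N)"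
      using y(2) by (simp only: P_eq[OF reduction_imp_min_valued[OF y(1)]])
  qed
  moreover have "\<exists>N. P x N"
    using min_valued_imp_reduction[OF x]
    unfolding P_def minimal_reduction_def eventually_sequentially by blast
  hence "P x (LEAST N. P x N)" by (rule LeastI_ex)
  ultimately have "P x (reduction_exponent R I)" by simp
  thus ?thesis using n unfolding P_def by blast
qed

lemma multiplicity_eq:
  assumes x: "min_valued x"
  shows "int (multiplicity_of R I) = v x"
proof -
  have len: "int (len R R ((*) y ` R)) = v y" if y: "min_valued y" for y
  proof -
    note y' = min_valuedD[OF y]
    have "(*) y ` R \<subseteq> R" using y'(1) I_le_R is_subringD(6)[OF subring] by auto
    thus ?thesis
      using len_eq_vlen[OF R_fractional scale_fractional[OF R_fractional y'(2)]]
        vlen_scale_self[OF R_fractional y'(2)] by simp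
  qed
  have "multiplicity_of R I = len R R ((*) x ` R)"
    unfolding multiplicity_of_def
  proof (rule the_equality)
    show "\<exists>y. minimal_reduction R I y \<and> len R R ((*) x ` R) = len R R ((*) y ` R)"
      using min_valued_imp_reduction[OF x] by blast
  next
    fix k assume "\<exists>y. minimal_reduction R I y \<and> k = len R R ((*) y ` R)"
    then obtain y where y: "min_valued y" "k = len R R ((*) y ` R)"
      using reduction_imp_min_valued by blast
    have "v y = v x"
      using min_valuedD(3)[OF x min_valuedD(1,2)[OF y(1)]]
        min_valuedD(3)[OF y(1) min_valuedD(1,2)[OF x]] by simp
    hence "int k = int (len R R ((*) x ` R))" using len[OF x] len[OF y(1)] y(2) by simp
    thus "k = len R R ((*) x ` R)" by simp
  qed
  thus ?thesis using len[OF x] by simp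
qed

text \<open>
  The stable module \<open>B = x\<^sup>-\<^sup>\<nu> I\<^sup>\<nu>\<close> satisfies \<open>BB = B\<close> and contains \<open>1\<close>, so it is a ring and
  \<open>I\<^sup>n : I\<^sup>n = x\<^sup>n B : x\<^sup>n B = B\<close> for \<open>n \<ge> \<nu>\<close>.  The smaller exponents contribute nothing new,
  since every element of \<open>I\<^sup>n : I\<^sup>n\<close> maps \<open>I\<^sup>n\<^sup>+\<^sup>\<nu>\<close> into itself.
\<close>

lemma blowup_properties:
  assumes x: "min_valued x"
  shows "n \<ge> reduction_exponent R I \<Longrightarrow> fpow R I n = (*) (x ^ n) ` blowup R I"
    and "is_subring (blowup R I)" and "R \<subseteq> blowup R I" and "blowup R I \<subseteq> val_ge 0"
proof -
  define \<nu> where "\<nu> = reduction_exponent R I"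
  note x0 = min_valuedD(2)[OF x] and xI = min_valuedD(1)[OF x]
  define B where "B = (*) (inverse (x ^ \<nu>)) ` fpow R I \<nu>"
  have inv0: "inverse (x ^ \<nu>) \<noteq> 0" using x0 by simp
  have pow: "fpow R I n = (*) (x ^ n) ` B" if "\<nu> \<le> n" for n
    using that
  proof (induction n rule: dec_induct)
    case base
    show ?case using x0 by (simp add: B_def scale_scale)
  next
    case (step n)
    hence "fpow R I (Suc n) = (*) x ` (*) (x ^ n) ` B"
      using reduction_exponent_property[OF x, of n] by (simp add: \<nu>_def)
    thus ?case by (simp add: scale_scale)
  qed
  have B_sub: "is_submodule R B" unfolding B_def by (rule scale_submodule[OF pow_submodule])
  have one: "1 \<in> B"
    unfolding B_def mem_scale_iff[OF inv0] using power_mem_pow[OF xI] by (simp add: divide_inverse)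
  have "(*) (x ^ (\<nu> + \<nu>)) ` fprod B B = fpow R I (\<nu> + \<nu>)"
    unfolding fpow_add[OF subring I_submodule] pow[OF order_refl] fprod_scale fprod_scale_right
    by (simp add: scale_scale power_add)
  also have "\<dots> = (*) (x ^ (\<nu> + \<nu>)) ` B" by (rule pow) simp
  finally have BB: "fprod B B = B" using scale_inject(1)[of "x ^ (\<nu> + \<nu>)"] x0 by simp
  have B_ring: "is_subring B"
    using one is_submodule_diff[OF subring B_sub] fprod_memI[of _ B _ B]
    unfolding is_subring_def BB by blast
  have B_colon: "colon B B = B"
    by (rule colon_ring_self[OF B_ring is_submodule_self[OF B_ring]])
  have colon_eq: "colon (fpow R I n) (fpow R I n) = B" if "\<nu> \<le> n" for n
    using x0 B_colon unfolding pow[OF that]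
    by (simp add: colon_scale_left colon_scale_right scale_scale)
  have "colon (fpow R I n) (fpow R I n) \<subseteq> B" for n
  proof
    fix y assume y: "y \<in> colon (fpow R I n) (fpow R I n)"
    have "fpow R I (n + \<nu>) \<subseteq> {z. y * z \<in> fpow R I (n + \<nu>)}"
      unfolding fpow_add[OF subring I_submodule]
    proof (rule fprod_subset)
      fix a b assume "a \<in> fpow R I n" "b \<in> fpow R I \<nu>"
      hence "(y * a) * b \<in> fprod (fpow R I n) (fpow R I \<nu>)"
        using y by (intro fprod_memI) (auto simp: colon_def)
      thus "a * b \<in> {z. y * z \<in> fprod (fpow R I n) (fpow R I \<nu>)}" by (simp add: mult.assoc)
    qed (simp add: distrib_left fprod_add)
    hence "y \<in> colon (fpow R I (n + \<nu>)) (fpow R I (n + \<nu>))" by (auto simp: colon_def)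
    thus "y \<in> B" using colon_eq[of "n + \<nu>"] by simp
  qed
  hence blowup: "blowup R I = B" unfolding blowup_def using colon_eq[OF order_refl] by blast
  show "is_subring (blowup R I)" using B_ring blowup by simp
  show "fpow R I n = (*) (x ^ n) ` blowup R I" if "n \<ge> reduction_exponent R I"
    using pow that unfolding blowup \<nu>_def .
  show "R \<subseteq> blowup R I"
    unfolding blowup using is_submoduleD(3)[OF B_sub _ one] by auto
  have "B \<subseteq> (*) (inverse (x ^ \<nu>)) ` val_ge (int \<nu> * v x)"
    unfolding B_def by (rule image_mono[OF pow_le_val[OF x]])
  also have "\<dots> = val_ge 0" using x0 by (simp add: val_ge_scale[OF inv0] v_inverse v_power)
  finally show "blowup R I \<subseteq> val_ge 0" by (simp add: blowup)
qed

text \<open>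
  If the blowing-up is \<open>R\<close>, then \<open>I\<^sup>n = x\<^sup>n R\<close> for large \<open>n\<close>, so \<open>I\<close> is invertible.  The exponent
  \<open>\<nu> + 1\<close> is used because it is positive.
\<close>

lemma trivial_blowup_imp_principal:
  assumes "blowup R I = R"
  shows "\<exists>a\<in>I. a \<noteq> 0 \<and> I = (*) a ` R"
proof -
  obtain x where x: "min_valued x" using min_valued_exists by (rule exE)
  define n where "n = Suc (reduction_exponent R I)"
  have x0: "x ^ n \<noteq> 0" using min_valuedD(2)[OF x] by simp
  define L where "L = (*) (inverse (x ^ n)) ` fpow R I (reduction_exponent R I)"
  have "fprod I L = (*) (inverse (x ^ n)) ` fpow R I n"
    by (simp add: L_def n_def fprod_scale_right)
  also have "fpow R I n = (*) (x ^ n) ` R"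
    using blowup_properties(1)[OF x, of n] assms by (simp add: n_def)
  also have "(*) (inverse (x ^ n)) ` \<dots> = R"
    by (simp only: scale_scale left_inverse[OF x0]) simp
  finally have "fprod I L = R" .
  moreover have "is_submodule R L" unfolding L_def by (rule scale_submodule[OF pow_submodule])
  ultimately show ?thesis using invertible_imp_principal[OF I_fractional] by simp
qed

end

section \<open>The genus formula and the equality case\<close>

locale almost_gorenstein_ideal =
  almost_gorenstein_branch v R \<omega> + branch_ideal v R I
  for v :: "'a::field \<Rightarrow> int" and R \<omega> I :: "'a set" +
  assumes not_principal: "\<not> (\<exists>a\<in>I. a \<noteq> 0 \<and> I = (*) a ` R)"
begin

abbreviation \<Lambda> :: "'a set" where "\<Lambda> \<equiv> blowup R I"
abbreviation \<nu> :: nat where "\<nu> \<equiv> reduction_exponent R I"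
abbreviation e :: nat where "e \<equiv> multiplicity_of R I"

definition x :: 'a where "x = (SOME x. min_valued x)"

lemma x_min_valued: "min_valued x"
  unfolding x_def by (rule someI_ex[OF min_valued_exists])

lemmas x_nonzero = min_valuedD(2)[OF x_min_valued]
lemmas pow_eq = blowup_properties(1)[OF x_min_valued]
lemmas blowup_ring = blowup_properties(2)[OF x_min_valued]
lemmas R_le_blowup = blowup_properties(3)[OF x_min_valued]
lemmas blowup_le = blowup_properties(4)[OF x_min_valued]

lemma power_nonzero: "x ^ n \<noteq> 0"
  using x_nonzero by simp

lemma v_power_x: "v (x ^ n) = int e * int n"
  using v_power[OF x_nonzero, of n] multiplicity_eq[OF x_min_valued] by (simp add: mult.commute)

lemma blowup_neq_R: "\<Lambda> \<noteq> R"
  using trivial_blowup_imp_principal not_principal by blast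

sublocale blowup: canonical_branch v \<Lambda> "colon \<omega> \<Lambda>"
  by (rule overring_canonical[OF blowup_ring R_le_blowup blowup_le])

lemma blowup_fractional: "is_fractional R \<Lambda>"
  by (rule is_fractional_antimono[OF R_le_blowup blowup.R_fractional])

lemma colon_blowup_fractional: "is_fractional R (colon R \<Lambda>)"
  by (rule colon_fractional[OF R_fractional blowup_fractional])

lemma colon_blowup_le_R: "colon R \<Lambda> \<subseteq> R"
  using colon_mono[OF subset_refl R_le_blowup, of R]
    colon_ring_self[OF subring is_submodule_self[OF subring]] by simp

lemma pow_le_colon: "fpow R I \<nu> \<subseteq> colon R \<Lambda>"
proof
  fix z assume z: "z \<in> fpow R I \<nu>"
  then obtain y where y: "y \<in> \<Lambda>" "z = x ^ \<nu> * y" using pow_eq[OF order_refl] by blast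
  have "z * s \<in> R" if "s \<in> \<Lambda>" for s
  proof -
    have "y * s \<in> \<Lambda>" using is_subringD(6)[OF blowup_ring] y(1) that .
    hence "x ^ \<nu> * (y * s) \<in> fpow R I \<nu>" unfolding pow_eq[OF order_refl] by (rule imageI)
    hence "x ^ \<nu> * (y * s) \<in> R" using pow_le_R by blast
    thus ?thesis by (simp add: y(2) mult.assoc)
  qed
  thus "z \<in> colon R \<Lambda>" by (simp add: colon_def)
qed

lemma blowup_le_bidual: "\<Lambda> \<subseteq> bidual R \<Lambda>"
  by (auto simp: bidual_def colon_def mult.commute)

lemma bidual_fractional: "is_fractional R (bidual R \<Lambda>)"
  unfolding bidual_def by (rule colon_fractional[OF R_fractional colon_blowup_fractional])

text \<open>
  All lengths are read off the chain \<open>I\<^sup>\<nu> \<subseteq> R : \<Lambda> \<subseteq> R \<subseteq> \<Lambda> \<subseteq> \<Lambda>\<^sup>*\<^sup>*\<close>.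
\<close>

lemma genus_formula:
  "2 * int (vlen \<Lambda> R) = int e * int \<nu> + int (vlen \<omega> R)
     - int (vlen (colon R \<Lambda>) (fpow R I \<nu>)) - int (vlen (bidual R \<Lambda>) \<Lambda>)"
proof -
  have pow: "fpow R I \<nu> = (*) (x ^ \<nu>) ` \<Lambda>" by (rule pow_eq[OF order_refl])
  have le: "fpow R I \<nu> \<subseteq> R" "fpow R I \<nu> \<subseteq> \<Lambda>" using pow_le_R R_le_blowup by blast+
  have "int (vlen \<Lambda> (fpow R I \<nu>)) = int e * int \<nu>"
    using vlen_scale_self[OF blowup_fractional power_nonzero[of \<nu>]] le(2) v_power_x[of \<nu>]
    by (simp add: pow)
  moreover have "vlen \<Lambda> (fpow R I \<nu>) = vlen \<Lambda> R + vlen R (fpow R I \<nu>)"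
    by (rule vlen_add[OF blowup_fractional pow_fractional le(1) R_le_blowup])
  moreover have "vlen R (fpow R I \<nu>) = vlen R (colon R \<Lambda>) + vlen (colon R \<Lambda>) (fpow R I \<nu>)"
    by (rule vlen_add[OF R_fractional pow_fractional pow_le_colon colon_blowup_le_R])
  moreover have "vlen (bidual R \<Lambda>) R = vlen \<omega> R + vlen R (colon R \<Lambda>)"
    by (rule vlen_bidual[OF blowup_ring R_le_blowup blowup_le blowup_neq_R])
  moreover have "vlen (bidual R \<Lambda>) R = vlen (bidual R \<Lambda>) \<Lambda> + vlen \<Lambda> R"
    by (rule vlen_add[OF bidual_fractional R_fractional R_le_blowup blowup_le_bidual])
  ultimately show ?thesis by linarith
qed

text \<open>
  The error terms are lengths, so equality makes \<open>R : \<Lambda>\<close> equal to \<open>I\<^sup>\<nu>\<close>.  Conversely, if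
  \<open>R : \<Lambda> = x\<^sup>\<nu> \<Lambda>\<close>, then \<open>\<Lambda>\<^sup>*\<^sup>* = x\<^sup>-\<^sup>\<nu> (R : \<Lambda>) = \<Lambda>\<close>.
\<close>

lemma genus_extremal_iff:
  "2 * int (vlen \<Lambda> R) = int e * int \<nu> + int (vlen \<omega> R) \<longleftrightarrow> colon R \<Lambda> = fpow R I \<nu>"
proof
  assume "2 * int (vlen \<Lambda> R) = int e * int \<nu> + int (vlen \<omega> R)"
  hence "vlen (colon R \<Lambda>) (fpow R I \<nu>) = 0" using genus_formula by linarith
  thus "colon R \<Lambda> = fpow R I \<nu>"
    using vlen_eq_0_iff[OF colon_blowup_fractional pow_fractional pow_le_colon] by simp
next
  assume eq: "colon R \<Lambda> = fpow R I \<nu>"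
  have "bidual R \<Lambda> = colon R ((*) (x ^ \<nu>) ` \<Lambda>)"
    by (simp add: bidual_def eq pow_eq[OF order_refl, symmetric])
  also have "\<dots> = (*) (inverse (x ^ \<nu>)) ` (*) (x ^ \<nu>) ` \<Lambda>"
    by (simp only: colon_scale_right[OF power_nonzero] eq pow_eq[OF order_refl])
  also have "\<dots> = \<Lambda>"
  proof -
    have "inverse (x ^ \<nu>) * x ^ \<nu> = 1" by (rule left_inverse[OF power_nonzero])
    thus ?thesis by (simp only: scale_scale) simp
  qed
  finally have "vlen (bidual R \<Lambda>) \<Lambda> = 0" by (simp add: vlen_def)
  moreover have "vlen (colon R \<Lambda>) (fpow R I \<nu>) = 0" by (simp add: eq vlen_def)
  ultimately show "2 * int (vlen \<Lambda> R) = int e * int \<nu> + int (vlen \<omega> R)" using genus_formula by simp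
qed

text \<open>
  Here and in the next lemmas the conditions that hold in the extremal case are reduced to
  \<open>\<omega>\<Lambda> = \<Lambda>\<close>; for powers of \<open>I\<close> this is cancellation of \<open>x\<^sup>n\<close>.
\<close>

lemma omega_pow_iff:
  assumes "\<nu> \<le> n"
  shows "fprod \<omega> (fpow R I n) = fpow R I n \<longleftrightarrow> fprod \<omega> \<Lambda> = \<Lambda>"
  unfolding pow_eq[OF assms] fprod_scale_right scale_inject(1)[OF power_nonzero] ..

lemma omega_colon_iff: "colon \<omega> \<Lambda> = colon R \<Lambda> \<longleftrightarrow> fprod \<omega> \<Lambda> = \<Lambda>"
  using dual_inject[OF blowup_fractional fprod_fractional[OF omega_fractional blowup_fractional]]
  unfolding R_colon_eq[of \<Lambda>] by auto

lemma one_in_omega: "1 \<in> \<omega>"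
  using R_le_omega is_subringD(1)[OF subring] by blast

lemma le_omega_prod: "J \<subseteq> fprod \<omega> J"
  using fprod_memI[OF one_in_omega, of _ J] by auto

lemma omega_le_iff: "\<omega> \<subseteq> \<Lambda> \<longleftrightarrow> fprod \<omega> \<Lambda> = \<Lambda>"
proof
  assume "\<omega> \<subseteq> \<Lambda>"
  hence "fprod \<omega> \<Lambda> \<subseteq> fprod \<Lambda> \<Lambda>" by (rule fprod_mono[OF _ subset_refl])
  thus "fprod \<omega> \<Lambda> = \<Lambda>" using le_omega_prod[of \<Lambda>] fprod_square[OF blowup_ring] by simp
next
  assume eq: "fprod \<omega> \<Lambda> = \<Lambda>"
  show "\<omega> \<subseteq> \<Lambda>"
  proof
    fix w assume "w \<in> \<omega>"
    hence "w * 1 \<in> fprod \<omega> \<Lambda>" by (rule fprod_memI[OF _ is_subringD(1)[OF blowup_ring]])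
    thus "w \<in> \<Lambda>" by (simp add: eq)
  qed
qed

lemma omega_pow_all_iff: "(\<forall>n\<ge>\<nu>. fprod \<omega> (fpow R I n) = fpow R I n) \<longleftrightarrow> fprod \<omega> \<Lambda> = \<Lambda>"
  using omega_pow_iff by blast

lemma omega_pow_ex_iff: "(\<exists>n>0. fprod \<omega> (fpow R I n) = fpow R I n) \<longleftrightarrow> fprod \<omega> \<Lambda> = \<Lambda>"
proof
  assume "\<exists>n>0. fprod \<omega> (fpow R I n) = fpow R I n"
  then obtain n where "fprod \<omega> (fpow R I n) = fpow R I n" by blast
  hence "fprod \<omega> (fpow R I (n + \<nu>)) = fpow R I (n + \<nu>)"
    by (simp add: fpow_add[OF subring I_submodule] fprod_assoc[symmetric])
  thus "fprod \<omega> \<Lambda> = \<Lambda>" using omega_pow_iff[of "n + \<nu>"] by simp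
next
  assume "fprod \<omega> \<Lambda> = \<Lambda>"
  hence "fprod \<omega> (fpow R I (Suc \<nu>)) = fpow R I (Suc \<nu>)" using omega_pow_iff[of "Suc \<nu>"] by simp
  thus "\<exists>n>0. fprod \<omega> (fpow R I n) = fpow R I n" by blast
qed

text \<open>
  For large \<open>n\<close> the values in \<open>I\<^sup>n\<omega>\<close> are so large that \<open>I\<^sup>n\<omega>\<close> lies in the conductor, hence in
  \<open>R\<close>, and the intersection with \<open>R\<close> can be dropped.
\<close>

lemma omega_pow_Int_iff:
  "(\<forall>n\<ge>\<nu>. fpow R I n = fprod (fpow R I n) \<omega> \<inter> R) \<longleftrightarrow> fprod \<omega> \<Lambda> = \<Lambda>"
proof
  assume eq: "\<forall>n\<ge>\<nu>. fpow R I n = fprod (fpow R I n) \<omega> \<inter> R"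
  obtain N where N: "val_ge N \<subseteq> R" using conductor_exists by blast
  define n where "n = max \<nu> (nat N)"
  have "\<nu> \<le> n" by (simp add: n_def)
  have "N \<le> int n" by (simp add: n_def)
  also have "\<dots> \<le> int n * v x" using min_valuedD(4)[OF x_min_valued] by (simp add: mult_le_cancel_left1)
  finally have "val_ge (int n * v x) \<subseteq> R" using val_ge_mono N by blast
  moreover have "fprod (fpow R I n) \<omega> \<subseteq> val_ge (int n * v x)"
  proof (rule fprod_subset)
    fix i j assume "i \<in> fpow R I n" "j \<in> \<omega>"
    hence "i \<in> val_ge (int n * v x)" "j \<in> val_ge 0"
      using pow_le_val[OF x_min_valued] omega_le by blast+
    thus "i * j \<in> val_ge (int n * v x)" using val_ge_mult[of i "int n * v x" j 0] by simp
  qed (rule val_ge_add)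
  ultimately have "fprod (fpow R I n) \<omega> \<inter> R = fprod (fpow R I n) \<omega>" by blast
  hence "fprod \<omega> (fpow R I n) = fpow R I n" using eq \<open>\<nu> \<le> n\<close> by (simp add: fprod_commute)
  thus "fprod \<omega> \<Lambda> = \<Lambda>" using omega_pow_iff[OF \<open>\<nu> \<le> n\<close>] by simp
next
  assume "fprod \<omega> \<Lambda> = \<Lambda>"
  hence "fprod (fpow R I n) \<omega> = fpow R I n" if "\<nu> \<le> n" for n
    using omega_pow_iff[OF that] fprod_commute[of \<omega>] by simp
  thus "\<forall>n\<ge>\<nu>. fpow R I n = fprod (fpow R I n) \<omega> \<inter> R" using pow_le_R by auto
qed

lemma colon_pow_imp_omega_stable:
  assumes "colon R \<Lambda> = fpow R I \<nu>"
  shows "fprod \<omega> \<Lambda> = \<Lambda>"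
proof -
  have "\<not> \<Lambda> \<subseteq> R" using R_le_blowup blowup_neq_R by blast
  hence "fprod \<omega> (fpow R I \<nu>) = fpow R I \<nu>"
    using overring_conductor_stable[OF blowup_ring blowup_le] assms by simp
  thus ?thesis using omega_pow_iff[OF order_refl] by simp
qed

lemma colon_pow_iff_dual: "colon R \<Lambda> = fpow R I \<nu> \<longleftrightarrow> colon \<omega> \<Lambda> = fpow R I \<nu>"
proof
  assume "colon R \<Lambda> = fpow R I \<nu>"
  thus "colon \<omega> \<Lambda> = fpow R I \<nu>" using colon_pow_imp_omega_stable omega_colon_iff by simp
next
  assume "colon \<omega> \<Lambda> = fpow R I \<nu>"
  thus "colon R \<Lambda> = fpow R I \<nu>"
    using pow_le_colon colon_mono[OF R_le_omega subset_refl, of \<Lambda>] by simp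
qed

text \<open>
  Since \<open>\<omega>\<close> lies between \<open>R\<close> and the normalisation \<open>V\<close>, one has \<open>\<omega>V = V\<close>.
\<close>

lemma conductor_omega: "colon R (val_ge 0) = colon \<omega> (val_ge 0)"
proof
  show "colon R (val_ge 0) \<subseteq> colon \<omega> (val_ge 0)" by (rule colon_mono[OF R_le_omega subset_refl])
  have "fprod \<omega> (val_ge 0) = val_ge 0"
  proof
    have "fprod \<omega> (val_ge 0) \<subseteq> fprod (val_ge 0) (val_ge 0)"
      by (rule fprod_mono[OF omega_le subset_refl])
    thus "fprod \<omega> (val_ge 0) \<subseteq> val_ge 0" by (simp add: fprod_square[OF val_ge_is_subring])
  qed (rule le_omega_prod)
  thus "colon \<omega> (val_ge 0) \<subseteq> colon R (val_ge 0)" by (simp add: R_colon_eq)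
qed

text \<open>
  The conductor of \<open>R\<close> is \<open>\<omega> : V = (\<omega> : \<Lambda>) : V = z (\<Lambda> : V)\<close>, that is, \<open>z\<close> times the conductor
  of \<open>\<Lambda>\<close>.
\<close>

lemma conductor_difference:
  assumes z: "z \<noteq> 0" "colon \<omega> \<Lambda> = (*) z ` \<Lambda>"
  shows "int (vlen (val_ge 0) (colon R (val_ge 0))) - int (vlen (val_ge 0) (colon \<Lambda> (val_ge 0))) = v z"
proof -
  have "fprod \<Lambda> (val_ge 0) = val_ge 0"
    by (rule fprod_ring_left[OF blowup_ring is_submodule_antimono[OF blowup_le val_ge_submodule]])
  hence "colon R (val_ge 0) = colon (colon \<omega> \<Lambda>) (val_ge 0)"
    using colon_fprod[OF omega_submodule, of \<Lambda> "val_ge 0"] by (simp add: conductor_omega)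
  hence eq: "colon R (val_ge 0) = (*) z ` colon \<Lambda> (val_ge 0)"
    by (simp add: z(2) colon_scale_left[OF z(1)])
  have le: "colon R (val_ge 0) \<subseteq> colon \<Lambda> (val_ge 0)" by (rule colon_mono[OF R_le_blowup subset_refl])
  have le': "colon \<Lambda> (val_ge 0) \<subseteq> val_ge 0" by (rule colon_val_ge_subset[OF blowup_le])
  have fr: "is_fractional R (colon \<Lambda> (val_ge 0))" "is_fractional R (colon R (val_ge 0))"
    by (rule colon_fractional[OF blowup_fractional val_ge_fractional],
        rule colon_fractional[OF R_fractional val_ge_fractional])
  have "int (vlen (colon \<Lambda> (val_ge 0)) (colon R (val_ge 0))) = v z"
    using vlen_scale_self[OF fr(1) z(1)] le unfolding eq by simp
  thus ?thesis using vlen_add[OF val_ge_fractional fr(2) le le'] by simp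
qed

text \<open>
  The ideal \<open>\<omega> : \<Lambda>\<close> is canonical for \<open>\<Lambda>\<close>.  If it equals \<open>x\<^sup>\<nu> \<Lambda>\<close>, then dividing by \<open>x\<^sup>\<nu>\<close>
  shows that \<open>\<Lambda>\<close> is canonical for itself.  If \<open>\<Lambda>\<close> is Gorenstein, then \<open>\<omega> : \<Lambda> = z\<Lambda>\<close>; this
  contains \<open>x\<^sup>\<nu>\<close>, which has the value of \<open>z\<close> by the condition on the conductors, so
  \<open>x\<^sup>\<nu> / z\<close> is a unit of \<open>\<Lambda>\<close>.
\<close>

lemma gorenstein_iff_dual:
  "gorenstein \<Lambda> \<and> int (vlen (val_ge 0) (colon R (val_ge 0)))
       - int (vlen (val_ge 0) (colon \<Lambda> (val_ge 0))) = int e * int \<nu>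
     \<longleftrightarrow> colon \<omega> \<Lambda> = fpow R I \<nu>"
proof
  assume eq: "colon \<omega> \<Lambda> = fpow R I \<nu>"
  hence eq': "colon \<omega> \<Lambda> = (*) (x ^ \<nu>) ` \<Lambda>" by (simp add: pow_eq[OF order_refl, symmetric])
  have "(*) (inverse (x ^ \<nu>)) ` colon \<omega> \<Lambda> = \<Lambda>"
  proof -
    have "inverse (x ^ \<nu>) * x ^ \<nu> = 1" by (rule left_inverse[OF power_nonzero])
    thus ?thesis by (simp only: eq' scale_scale) simp
  qed
  hence "gorenstein \<Lambda>"
    using blowup.scale_canonical[of "inverse (x ^ \<nu>)"] power_nonzero[of \<nu>]
    by (simp add: blowup.gorenstein_iff)
  thus "gorenstein \<Lambda> \<and> int (vlen (val_ge 0) (colon R (val_ge 0)))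
       - int (vlen (val_ge 0) (colon \<Lambda> (val_ge 0))) = int e * int \<nu>"
    using conductor_difference[OF power_nonzero eq'] by (simp add: v_power_x)
next
  assume *: "gorenstein \<Lambda> \<and> int (vlen (val_ge 0) (colon R (val_ge 0)))
       - int (vlen (val_ge 0) (colon \<Lambda> (val_ge 0))) = int e * int \<nu>"
  obtain z where z: "z \<noteq> 0" "colon \<omega> \<Lambda> = (*) z ` \<Lambda>"
    using blowup.gorenstein_imp_principal * by blast
  have vz: "v z = v (x ^ \<nu>)" using conductor_difference[OF z] * by (simp add: v_power_x)
  have "x ^ \<nu> \<in> fpow R I \<nu>" by (rule power_mem_pow[OF min_valuedD(1)[OF x_min_valued]])
  moreover have "fpow R I \<nu> \<subseteq> colon \<omega> \<Lambda>"
    using pow_le_colon colon_mono[OF R_le_omega subset_refl, of \<Lambda>] by blast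
  ultimately have "x ^ \<nu> \<in> (*) z ` \<Lambda>" unfolding z(2) by blast
  hence "x ^ \<nu> / z \<in> \<Lambda>" unfolding mem_scale_iff[OF z(1)] .
  moreover have "x ^ \<nu> / z \<noteq> 0" using power_nonzero[of \<nu>] z(1) by simp
  moreover have "v (x ^ \<nu> / z) = 0" using v_divide[OF power_nonzero z(1)] vz by simp
  ultimately have unit: "(*) (x ^ \<nu> / z) ` \<Lambda> = \<Lambda>" by (rule blowup.scale_unit_R)
  have "fpow R I \<nu> = (*) (z * (x ^ \<nu> / z)) ` \<Lambda>" using pow_eq[OF order_refl] z(1) by simp
  also have "\<dots> = (*) z ` \<Lambda>" unfolding scale_scale[symmetric] unit ..
  finally show "colon \<omega> \<Lambda> = fpow R I \<nu>" using z(2) by simp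
qed

end

section \<open>From ring-theoretic hypotheses to a valuation\<close>

lemma subset_int_closure:
  assumes "is_subring R"
  shows "R \<subseteq> int_closure R"
proof
  fix a assume a: "a \<in> R"
  have "poly.coeff [:- a, 1:] i \<in> R" for i
    using a is_subringD[OF assms] by (cases i; cases "i - 1") (simp_all add: coeff_pCons split: nat.split)
  hence "range (poly.coeff [:- a, 1:]) \<subseteq> R" by blast
  thus "a \<in> int_closure R"
    unfolding int_closure_def by (intro CollectI exI[of _ "[:- a, 1:]"]) simp
qed

lemma common_denominator:
  assumes R: "is_subring R" "is_quotient_field_of R" and "finite B"
  shows "\<exists>d\<in>R. d \<noteq> 0 \<and> (\<forall>b\<in>B. d * b \<in> R)"
  using assms(3)
proof (induction B rule: finite_induct)
  case empty
  show ?case using is_subringD(1)[OF R(1)] by (intro bexI[of _ 1]) simp_all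
next
  case (insert b B)
  then obtain d where d: "d \<in> R" "d \<noteq> 0" "\<And>b. b \<in> B \<Longrightarrow> d * b \<in> R" by blast
  obtain p q where pq: "p \<in> R" "q \<in> R" "q \<noteq> 0" "b = p / q"
    using R(2) unfolding is_quotient_field_of_def by blast
  note mult = is_subringD(6)[OF R(1)]
  have "d * q \<in> R" "d * q \<noteq> 0" using mult d pq by simp_all
  moreover have "d * q * c \<in> R" if "c \<in> insert b B" for c
  proof (cases "c = b")
    case True
    hence "d * q * c = d * p" using pq by simp
    thus ?thesis using mult[OF d(1) pq(1)] by (simp only:)
  next
    case False
    hence "q * (d * c) \<in> R" using mult d(3) pq(2) that by blast
    thus ?thesis by (simp add: ac_simps)
  qed
  ultimately show ?case by blast
qed

lemma finite_module_denominator: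
  assumes R: "is_subring R" "is_quotient_field_of R" and fin: "finite_module_over R S"
  shows "\<exists>d\<in>R. d \<noteq> 0 \<and> (*) d ` S \<subseteq> R"
proof -
  obtain B where B: "finite B" "S = {\<Sum>b\<in>B. f b * b | f. f ` B \<subseteq> R}"
    using fin unfolding finite_module_over_def by blast
  obtain d where d: "d \<in> R" "d \<noteq> 0" "\<And>b. b \<in> B \<Longrightarrow> d * b \<in> R"
    using common_denominator[OF R B(1)] by blast
  have sum: "sum g B \<in> R" if "\<And>b. b \<in> B \<Longrightarrow> g b \<in> R" for g
    using B(1) that by (induction rule: finite_induct) (simp_all add: is_subringD(2,3)[OF R(1)])
  have "d * y \<in> R" if y: "y \<in> S" for y
  proof -
    obtain f where f: "f ` B \<subseteq> R" "y = (\<Sum>b\<in>B. f b * b)" using y unfolding B(2) by blast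
    have "d * y = (\<Sum>b\<in>B. f b * (d * b))" unfolding f(2) sum_distrib_left by (simp add: ac_simps)
    also have "\<dots> \<in> R"
    proof (rule sum)
      fix b assume b: "b \<in> B"
      hence "f b \<in> R" using f(1) by blast
      thus "f b * (d * b) \<in> R" using is_subringD(6)[OF R(1)] d(3)[OF b] by blast
    qed
    finally show ?thesis .
  qed
  thus ?thesis using d(1,2) by blast
qed

text \<open>
  Surjectivity of the map of residue fields: the coset of \<open>y\<close> is \<open>\<nn> + C\<close> for a coset \<open>C\<close> of
  \<open>\<mm>\<close>, and \<open>C\<close> is contained in \<open>R\<close>.
\<close>

lemma residually_rational_imp:
  assumes W: "is_subring (int_closure R)" and RW: "R \<subseteq> int_closure R"
    and m: "\<mm> \<subseteq> R" and R: "is_subring R"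
    and n: "\<And>\<nn>'. local_ring (ring_on (int_closure R)) \<nn>' \<Longrightarrow> \<nn>' = \<nn>" and zero: "0 \<in> \<nn>"
    and rr: "residually_rational R \<mm>" and y: "y \<in> int_closure R"
  shows "\<exists>a\<in>R. y - a \<in> \<nn>"
proof -
  let ?W = "ring_on (int_closure R)"
  have iso: "(\<lambda>C. \<nn> <+>\<^bsub>?W\<^esub> C) \<in> ring_iso (ring_on R Quot \<mm>) (?W Quot \<nn>)"
    using rr n unfolding residually_rational_def by blast
  have "\<nn> +>\<^bsub>?W\<^esub> y \<in> carrier (?W Quot \<nn>)"
    using y by (auto simp: FactRing_def A_RCOSETS_def')
  moreover have "bij_betw (\<lambda>C. \<nn> <+>\<^bsub>?W\<^esub> C) (carrier (ring_on R Quot \<mm>)) (carrier (?W Quot \<nn>))"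
    using iso unfolding ring_iso_def by blast
  ultimately obtain C where C: "C \<in> carrier (ring_on R Quot \<mm>)" "\<nn> +>\<^bsub>?W\<^esub> y = \<nn> <+>\<^bsub>?W\<^esub> C"
    unfolding bij_betw_def by blast
  have "C \<subseteq> R"
    using C(1) m is_subringD(3)[OF R] by (auto simp: FactRing_def A_RCOSETS_def' a_r_coset_def')
  moreover have "y \<in> \<nn> +>\<^bsub>?W\<^esub> y" using zero by (force simp: a_r_coset_def')
  then obtain k c where "k \<in> \<nn>" "c \<in> C" "y = k + c"
    unfolding C(2) by (auto simp: set_add_def')
  ultimately show ?thesis by force
qed

text \<open>
  The elements of \<open>R\<close> of positive value form an ideal, and it is maximal because the elements of
  value \<open>0\<close> are units of \<open>R\<close>.
\<close>

lemma (in branch) maximal_ideal_eq: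
  assumes "local_ring (ring_on R) \<mm>"
  shows "\<mm> = R \<inter> val_ge 1"
proof -
  interpret R: cring "ring_on R" using assms by (simp add: local_ring_def)
  let ?m = "R \<inter> val_ge 1"
  have ideal: "ideal ?m (ring_on R)"
  proof (rule idealI)
    show "ring (ring_on R)" by (rule R.ring_axioms)
    show "subgroup ?m (add_monoid (ring_on R))"
    proof (rule group.subgroupI[OF R.a_group])
      show "?m \<subseteq> carrier (add_monoid (ring_on R))" by simp
      have "0 \<in> ?m" using is_subringD(2)[OF subring] by (simp add: val_ge_def)
      thus "?m \<noteq> {}" by blast
      fix a assume a: "a \<in> ?m"
      have "a + \<ominus>\<^bsub>ring_on R\<^esub> a = 0" using R.r_neg[of a] a by simp
      hence "inv\<^bsub>add_monoid (ring_on R)\<^esub> a = - a" by (simp add: add_eq_0_iff a_inv_def)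
      moreover have "- a \<in> ?m" using a is_subringD(4)[OF subring] by (simp add: val_ge_def)
      ultimately show "inv\<^bsub>add_monoid (ring_on R)\<^esub> a \<in> ?m" by simp
      fix b assume b: "b \<in> ?m"
      show "a \<otimes>\<^bsub>add_monoid (ring_on R)\<^esub> b \<in> ?m"
        using a b is_subringD(3)[OF subring] val_ge_add by simp
    qed
    fix a y assume ay: "a \<in> ?m" "y \<in> carrier (ring_on R)"
    hence "y \<in> val_ge 0" using R_le by auto
    hence "y * a \<in> ?m" using ay val_ge_mult[of y 0 a 1] is_subringD(6)[OF subring] by simp
    thus "y \<otimes>\<^bsub>ring_on R\<^esub> a \<in> ?m" "a \<otimes>\<^bsub>ring_on R\<^esub> y \<in> ?m" by (simp_all add: mult.commute)
  qed
  have one: "1 \<in> R" "1 \<notin> ?m" using is_subringD(1)[OF subring] by (simp_all add: val_ge_def)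
  have "maximalideal ?m (ring_on R)"
  proof (rule maximalidealI[OF ideal])
    show "carrier (ring_on R) \<noteq> ?m" using one by auto
    fix J assume J: "ideal J (ring_on R)" "?m \<subseteq> J" "J \<subseteq> carrier (ring_on R)"
    show "J = ?m \<or> J = carrier (ring_on R)"
    proof (rule disjCI)
      assume "J \<noteq> carrier (ring_on R)"
      hence one_J: "1 \<notin> J" using ideal.one_imp_carrier[OF J(1)] by auto
      have "y \<in> ?m" if y: "y \<in> J" for y
      proof (rule ccontr)
        assume no: "y \<notin> ?m"
        have yR: "y \<in> R" using y J(3) by auto
        hence "y \<noteq> 0" "v y < 1" using no by (simp_all add: val_ge_def)
        moreover have "y \<in> val_ge 0" using R_le yR by blast
        ultimately have "y \<noteq> 0" "v y = 0" by (simp_all add: val_ge_def)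
        hence "inverse y \<in> R" using inverse_unit[OF yR] by simp
        hence "inverse y * y \<in> J" using ideal.I_l_closed[OF J(1) y] by simp
        thus False using one_J \<open>y \<noteq> 0\<close> by simp
      qed
      thus "J = ?m" using J(2) by blast
    qed
  qed
  thus ?thesis using assms unfolding local_ring_def by blast
qed

text \<open>
  The valuation is that of the discrete valuation ring \<open>int_closure R\<close>.  A common denominator \<open>d\<close>
  of its finitely many generators over \<open>R\<close> gives \<open>d V \<subseteq> R\<close>, hence a nonzero conductor.
\<close>

lemma analytically_irreducible_branch:
  fixes R \<mm> :: "'a::field set"
  assumes R: "is_subring R" and quot: "is_quotient_field_of R" and loc: "local_ring (ring_on R) \<mm>"
    and ai: "analytically_irreducible R" and rr: "residually_rational R \<mm>"
  obtains v where "branch v R" "int_closure R = discrete_valuation.val_ge v 0"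
    "\<mm> = R \<inter> discrete_valuation.val_ge v 1"
proof -
  have dvr: "discrete_valuation_ring (ring_on (int_closure R))"
    and fin: "finite_module_over R (int_closure R)"
    using ai by (simp_all add: analytically_irreducible_def)
  obtain \<nn> where n: "local_ring (ring_on (int_closure R)) \<nn>"
    using dvr unfolding discrete_valuation_ring_def by blast
  have RW: "R \<subseteq> int_closure R" by (rule subset_int_closure[OF R])
  have "is_quotient_field_of (int_closure R)"
    using quot RW unfolding is_quotient_field_of_def by (meson subsetD)
  then obtain v where v: "discrete_valuation v" "int_closure R = discrete_valuation.val_ge v 0"
    "\<nn> = discrete_valuation.val_ge v 1"
    using dvr_valuation[OF dvr n] by blast
  interpret discrete_valuation v by (rule v(1))
  have W: "is_subring (int_closure R)" unfolding v(2) by (rule val_ge_is_subring)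
  have unique: "\<nn>' = \<nn>" if "local_ring (ring_on (int_closure R)) \<nn>'" for \<nn>'
    using n that unfolding local_ring_def by blast
  have "maximalideal \<mm> (ring_on R)" using loc by (simp add: local_ring_def)
  then interpret m: maximalideal \<mm> "ring_on R" .
  have mR: "\<mm> \<subseteq> R" using m.a_subset by simp
  have "branch v R"
  proof
    show "is_subring R" by (rule R)
    show "R \<subseteq> val_ge 0" using RW v(2) by simp
    show "\<exists>a\<in>R. y - a \<in> val_ge 1" if "y \<in> val_ge 0" for y
      using residually_rational_imp[OF W RW mR R unique _ rr, of y] that
      by (simp add: v(2)[symmetric] v(3)[symmetric]) (simp add: v(3) val_ge_def)
    obtain d where d: "d \<in> R" "d \<noteq> 0" "(*) d ` int_closure R \<subseteq> R"
      using finite_module_denominator[OF R quot fin] by blast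
    have "val_ge (v d + 0) \<subseteq> R" using d(3) unfolding v(2) val_ge_scale[OF d(2)] .
    thus "\<exists>n. val_ge n \<subseteq> R" by blast
  qed
  moreover from this interpret branch v R .
  have "\<mm> = R \<inter> val_ge 1" by (rule maximal_ideal_eq[OF loc])
  ultimately show ?thesis using that v(2) by blast
qed

theorem theorem5p3:
  fixes R \<mm> \<omega> I \<Lambda> :: "'a::field set"
    and e \<nu> \<rho> r c c\<^sub>\<Lambda> :: nat
  assumes "subring R ring_of_type_algebra"
    and "is_quotient_field_of R"
    and "noetherian_domain (ring_on R)"
    and "local_ring (ring_on R) \<mm>"
    and "krull_dim (ring_on R) = 1"
    and "infinite (carrier (ring_on R Quot \<mm>))"
    and "analytically_irreducible R"
    and "residually_rational R \<mm>"
    and "canonical_ideal R \<omega>" and "R \<subseteq> \<omega>" and "\<omega> \<subseteq> int_closure R"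
    and "almost_gorenstein \<mm> \<omega>"
    and "primary_ideal (ring_on R) I" and "radical_of (ring_on R) I = \<mm>"
    and "\<not> principalideal I (ring_on R)"
    and "r = cm_type R \<mm>"
    and "\<Lambda> = blowup R I"
    and "e = multiplicity_of R I" and "\<nu> = reduction_exponent R I" and "\<rho> = genus R I"
    and "c = len R (int_closure R) (conductor R R)"
    and "c\<^sub>\<Lambda> = len R (int_closure R) (conductor R \<Lambda>)"
  shows
    "2 * int \<rho> = int e * int \<nu> + int r - 1
        - int (len R (colon R \<Lambda>) (fpow R I \<nu>)) - int (len R (bidual R \<Lambda>) \<Lambda>)
     \<and>
     ((2 * int \<rho> = int e * int \<nu> + int r - 1)
        \<longleftrightarrow> (gorenstein \<Lambda> \<and> int c - int c\<^sub>\<Lambda> = int e * int \<nu>)) \<and>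
     ((gorenstein \<Lambda> \<and> int c - int c\<^sub>\<Lambda> = int e * int \<nu>)
        \<longleftrightarrow> colon R \<Lambda> = fpow R I \<nu>) \<and>
     (colon R \<Lambda> = fpow R I \<nu> \<longleftrightarrow> colon \<omega> \<Lambda> = fpow R I \<nu>)
     \<and>
     (2 * int \<rho> = int e * int \<nu> + int r - 1 \<longrightarrow>
        \<omega> \<subseteq> \<Lambda> \<and>
        fprod \<omega> \<Lambda> = \<Lambda> \<and>
        colon \<omega> \<Lambda> = colon R \<Lambda> \<and>
        (\<forall>n\<ge>\<nu>. fpow R I n = fprod (fpow R I n) \<omega> \<inter> R) \<and>
        (\<forall>n\<ge>\<nu>. fprod \<omega> (fpow R I n) = fpow R I n) \<and>
        (\<exists>n>0. fprod \<omega> (fpow R I n) = fpow R I n))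
     \<and>
     (\<omega> \<subseteq> \<Lambda> \<longleftrightarrow> fprod \<omega> \<Lambda> = \<Lambda>) \<and>
     (fprod \<omega> \<Lambda> = \<Lambda> \<longleftrightarrow> colon \<omega> \<Lambda> = colon R \<Lambda>) \<and>
     (colon \<omega> \<Lambda> = colon R \<Lambda> \<longleftrightarrow>
        (\<forall>n\<ge>\<nu>. fpow R I n = fprod (fpow R I n) \<omega> \<inter> R)) \<and>
     ((\<forall>n\<ge>\<nu>. fpow R I n = fprod (fpow R I n) \<omega> \<inter> R) \<longleftrightarrow>
        (\<forall>n\<ge>\<nu>. fprod \<omega> (fpow R I n) = fpow R I n)) \<and>
     ((\<forall>n\<ge>\<nu>. fprod \<omega> (fpow R I n) = fpow R I n) \<longleftrightarrow>
        (\<exists>n>0. fprod \<omega> (fpow R I n) = fpow R I n))"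
proof -
  have R: "is_subring R" by (rule subring_is_subring[OF assms(1)])
  obtain v where v: "branch v R" "int_closure R = discrete_valuation.val_ge v 0"
    "\<mm> = R \<inter> discrete_valuation.val_ge v 1"
    using analytically_irreducible_branch[OF R assms(2,4,7,8)] by blast
  interpret branch v R by (rule v(1))
  interpret canonical_branch v R \<omega> using assms(9) canonical_iff by simp
  interpret almost_gorenstein_branch v R \<omega>
  proof
    show "R \<subseteq> \<omega>" by (rule assms(10))
    show "\<omega> \<subseteq> val_ge 0" using assms(11) v(2) by simp
    show "fprod (R \<inter> val_ge 1) \<omega> = R \<inter> val_ge 1"
      using assms(12) unfolding almost_gorenstein_def v(3) by simp
  qed
  have I: "ideal I (ring_on R)" "I \<noteq> R" using assms(13) by (simp_all add: primary_ideal_def)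
  interpret I: ideal I "ring_on R" by (rule I(1))
  have I_R: "I \<subseteq> R" using I.a_subset by simp
  have I_sub: "is_submodule R I"
    using additive_subgroup.zero_closed[OF I.is_additive_subgroup]
      additive_subgroup.a_closed[OF I.is_additive_subgroup] I.I_l_closed
    by (simp add: is_submodule_def)
  \<comment> \<open>\<open>I \<noteq> {0}\<close>, since a power of a nonzero element of the maximal ideal lies in \<open>I\<close>.\<close>
  have I_fr: "is_fractional R I"
  proof -
    have pow: "a [^]\<^bsub>ring_on R\<^esub> (n::nat) = a ^ n" for a n
      by (induction n) (simp_all add: nat_pow_def mult.commute)
    obtain a where a: "a \<in> \<mm>" "a \<noteq> 0"
      using is_fractionalD(2)[OF maximal_ideal_fractional] v(3) by blast
    then obtain n :: nat where "a ^ n \<in> I" using assms(14) by (auto simp: radical_of_def pow)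
    moreover have "a ^ n \<noteq> 0" using a(2) by simp
    ultimately have "I \<noteq> {0}" by blast
    moreover have "I \<subseteq> val_ge 0" using I_R R_le by blast
    ultimately show ?thesis using I_sub unfolding is_fractional_def by blast
  qed
  \<comment> \<open>An element of value \<open>0\<close> would be a unit of \<open>R\<close>, but \<open>I \<noteq> R\<close>.\<close>
  have I_le: "I \<subseteq> val_ge 1"
  proof
    fix y assume y: "y \<in> I"
    have yR: "y \<in> R" using y I_R by blast
    have y0: "y \<in> val_ge 0" using yR R_le by blast
    show "y \<in> val_ge 1"
    proof (rule ccontr)
      assume "y \<notin> val_ge 1"
      hence *: "y \<noteq> 0" "v y = 0" using y0 by (auto simp: val_ge_def)
      hence "inverse y * y \<in> I" using is_submoduleD(3)[OF I_sub inverse_unit[OF yR] y] by simp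
      hence "1 \<in> I" using *(1) by simp
      thus False using I.one_imp_carrier I(2) by simp
    qed
  qed
  have not_pr: "\<not> (\<exists>a\<in>I. a \<noteq> 0 \<and> I = (*) a ` R)"
  proof
    assume "\<exists>a\<in>I. a \<noteq> 0 \<and> I = (*) a ` R"
    then obtain a where a: "a \<in> I" "I = (*) a ` R" by blast
    interpret cring "ring_on R" using assms(4) by (simp add: local_ring_def)
    have "I = PIdl\<^bsub>ring_on R\<^esub> a" using a(2) by (auto simp: cgenideal_def mult.commute)
    hence "I = Idl\<^bsub>ring_on R\<^esub> {a}" using cgenideal_eq_genideal[of a] a(1) I_R by auto
    hence "principalideal I (ring_on R)"
      using a(1) I_R by (intro principalidealI[OF I(1)]) auto
    thus False using assms(15) by simp
  qed
  interpret G: almost_gorenstein_ideal v R \<omega> I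
    by unfold_locales (fact I_fr I_R I_le not_pr)+
  have bid: "len R (bidual R \<Lambda>) \<Lambda> = vlen (bidual R \<Lambda>) \<Lambda>"
    unfolding assms(17)
    by (rule len_eq_vlen[OF G.bidual_fractional G.blowup_fractional G.blowup_le_bidual])
  have col: "len R (colon R \<Lambda>) (fpow R I \<nu>) = vlen (colon R \<Lambda>) (fpow R I \<nu>)"
    unfolding assms(17,19)
    by (rule len_eq_vlen[OF G.colon_blowup_fractional G.pow_fractional G.pow_le_colon])
  have rho: "\<rho> = vlen \<Lambda> R"
    unfolding assms(17,20) genus_def
    by (rule len_eq_vlen[OF G.blowup_fractional R_fractional G.R_le_blowup])
  have r: "int r - 1 = int (vlen \<omega> R)"
  proof -
    have "R \<subseteq> colon R (R \<inter> val_ge 1)"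
      using is_subringD(6)[OF R] by (auto simp: colon_def)
    hence "r = vlen (colon R (R \<inter> val_ge 1)) R"
      unfolding assms(16) cm_type_def v(3)
      by (rule len_eq_vlen[OF colon_fractional[OF R_fractional maximal_ideal_fractional] R_fractional])
    thus ?thesis by (simp add: vlen_type)
  qed
  have c: "c = vlen (val_ge 0) (colon R (val_ge 0))"
    unfolding assms(21) conductor_def v(2)
    by (rule len_eq_vlen[OF val_ge_fractional colon_fractional[OF R_fractional val_ge_fractional]
          colon_val_ge_subset[OF R_le]])
  have c\<Lambda>: "c\<^sub>\<Lambda> = vlen (val_ge 0) (colon \<Lambda> (val_ge 0))"
    unfolding assms(17,22) conductor_def v(2)
    by (rule len_eq_vlen[OF val_ge_fractional colon_fractional[OF G.blowup_fractional val_ge_fractional]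
          colon_val_ge_subset[OF G.blowup_le]])
  have one: "2 * int \<rho> = int e * int \<nu> + int r - 1
        - int (len R (colon R \<Lambda>) (fpow R I \<nu>)) - int (len R (bidual R \<Lambda>) \<Lambda>)"
    using G.genus_formula r unfolding bid col rho unfolding assms(17-19) by linarith
  have a_c: "2 * int \<rho> = int e * int \<nu> + int r - 1 \<longleftrightarrow> colon R \<Lambda> = fpow R I \<nu>"
    using G.genus_extremal_iff r unfolding rho assms(17-19) by (simp add: algebra_simps)
  have c_d: "colon R \<Lambda> = fpow R I \<nu> \<longleftrightarrow> colon \<omega> \<Lambda> = fpow R I \<nu>"
    unfolding assms(17,19) by (rule G.colon_pow_iff_dual)
  have b_d: "(gorenstein \<Lambda> \<and> int c - int c\<^sub>\<Lambda> = int e * int \<nu>) \<longleftrightarrow> colon \<omega> \<Lambda> = fpow R I \<nu>"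
    unfolding c c\<Lambda> assms(17-19) by (rule G.gorenstein_iff_dual)
  have c_omega: "colon R \<Lambda> = fpow R I \<nu> \<Longrightarrow> fprod \<omega> \<Lambda> = \<Lambda>"
    unfolding assms(17,19) by (rule G.colon_pow_imp_omega_stable)
  have iffs: "\<omega> \<subseteq> \<Lambda> \<longleftrightarrow> fprod \<omega> \<Lambda> = \<Lambda>" "colon \<omega> \<Lambda> = colon R \<Lambda> \<longleftrightarrow> fprod \<omega> \<Lambda> = \<Lambda>"
    "(\<forall>n\<ge>\<nu>. fpow R I n = fprod (fpow R I n) \<omega> \<inter> R) \<longleftrightarrow> fprod \<omega> \<Lambda> = \<Lambda>"
    "(\<forall>n\<ge>\<nu>. fprod \<omega> (fpow R I n) = fpow R I n) \<longleftrightarrow> fprod \<omega> \<Lambda> = \<Lambda>"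
    "(\<exists>n>0. fprod \<omega> (fpow R I n) = fpow R I n) \<longleftrightarrow> fprod \<omega> \<Lambda> = \<Lambda>"
    unfolding assms(17,19)
    by (rule G.omega_le_iff G.omega_colon_iff G.omega_pow_Int_iff G.omega_pow_all_iff
        G.omega_pow_ex_iff)+
  show ?thesis unfolding iffs a_c b_d using one c_d c_omega by blast
qed

end
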